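(* Let $n\in\mathbb{N}$, let $\alpha>0$, and let $f\colon[0,\alpha)\to\mathbb{R}$ be a continuous function such that $0\notin f([0,\alpha))$. For a positive integer $m$ consider the following assertions: $(4)_m$: $f$ is $m$-concave on $[0,\alpha)$ and $f(0)\ge 0$. $(5)_m$: for every self-adjoint $A\in M_m$ with spectrum contained in $[0,\alpha)$ and every contraction $C\in M_m$, one has $f(C^*AC)\ge C^*f(A)C$. $(6)_m$: the function $g(t)=\dfrac{t}{f(t)}$ is $m$-monotone on $(0,\alpha)$. Then $(4)_{n+1}$ implies $(5)_n$; $(5)_n$ and $(6)_n$ are equivalent; and $(6)_n$ implies $(4)_{[n/2]}$, where $[n/2]$ denotes the integer part of $n/2$.
   Context: $M_m$ is the algebra of all $m\times m$ complex matrices; inequalities between self-adjoint matrices refer to the order $X\le Y$ iff $Y-X$ is positive semi-definite; $f(A)$ is defined by functional calculus for self-adjoint $A$ with spectrum in the domain of $f$. A contraction is a matrix $C$ with operator norm $\|C\|\le 1$. Let $I\subset\mathbb{R}$ be an interval. A function $f\colon I\to\mathbb{R}$ is $m$-concave on $I$ if $f(\lambda A+(1-\lambda)B)\ge\lambda f(A)+(1-\lambda)f(B)$ for all $\lambda\in[0,1]$ and all self-adjoint $A,B\in M_m$ whose eigenvalues lie in $I$. It is $m$-monotone on $I$ if $A\le B$ implies $f(A)\le f(B)$ for all self-adjoint $A,B\in M_m$ whose eigenvalues lie in $I$. When $n=1$ one has $[n/2]=0$, and $(4)_0$ is regarded as a vacuous assertion. *)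

theory Defs
  imports
    "HOL-Analysis.L2_Norm"
    "Jordan_Normal_Form.Schur_Decomposition"
    "Jordan_Normal_Form.Spectral_Radius"
begin

definition hermitian_mat :: "nat \<Rightarrow> complex mat \<Rightarrow> bool" where
  "hermitian_mat m A \<longleftrightarrow> A \<in> carrier_mat m m \<and> mat_adjoint A = A"

definition unitary_mat :: "nat \<Rightarrow> complex mat \<Rightarrow> bool" where
  "unitary_mat m U \<longleftrightarrow>
     U \<in> carrier_mat m m \<and> U * mat_adjoint U = 1\<^sub>m m \<and> mat_adjoint U * U = 1\<^sub>m m"

text \<open>For complex numbers, \<open>0 \<le> z\<close> means that \<open>z\<close> is real and nonnegative.\<close>

definition psd_mat :: "nat \<Rightarrow> complex mat \<Rightarrow> bool" where
  "psd_mat m A \<longleftrightarrow> hermitian_mat m A \<and> (\<forall>v \<in> carrier_vec m. 0 \<le> (A *\<^sub>v v) \<bullet>c v)"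

definition loewner_le :: "nat \<Rightarrow> complex mat \<Rightarrow> complex mat \<Rightarrow> bool" where
  "loewner_le m X Y \<longleftrightarrow> hermitian_mat m X \<and> hermitian_mat m Y \<and> psd_mat m (Y - X)"

text \<open>
  Continuous functional calculus of a Hermitian matrix: if \<open>A = U diag(d) U*\<close> with \<open>U\<close> unitary
  and \<open>d\<close> real, then \<open>f(A) = U diag(f(d)) U*\<close>. Such a decomposition exists by the spectral
  theorem, and the result does not depend on it (lemma \<open>mat_fun_eqI\<close>). Only the values of \<open>f\<close>
  at the eigenvalues of \<open>A\<close> matter.
\<close>

definition mat_fun :: "(real \<Rightarrow> real) \<Rightarrow> complex mat \<Rightarrow> complex mat" where
  "mat_fun f A = (THE B. \<exists>U d. unitary_mat (dim_row A) U \<and>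
     A = U * mat_diag (dim_row A) (\<lambda>i. complex_of_real (d i)) * mat_adjoint U \<and>
     B = U * mat_diag (dim_row A) (\<lambda>i. complex_of_real (f (d i))) * mat_adjoint U)"

text \<open>Operator norm with respect to the Euclidean norm.\<close>

definition vec_l2norm :: "complex vec \<Rightarrow> real" where
  "vec_l2norm v = L2_set (\<lambda>i. cmod (v $ i)) {..<dim_vec v}"

definition mat_opnorm :: "complex mat \<Rightarrow> real" where
  "mat_opnorm C = (SUP v \<in> {v \<in> carrier_vec (dim_col C). vec_l2norm v \<le> 1}. vec_l2norm (C *\<^sub>v v))"

definition contraction_mat :: "nat \<Rightarrow> complex mat \<Rightarrow> bool" where
  "contraction_mat m C \<longleftrightarrow> C \<in> carrier_mat m m \<and> mat_opnorm C \<le> 1"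

definition hermitian_on :: "nat \<Rightarrow> real set \<Rightarrow> complex mat \<Rightarrow> bool" where
  "hermitian_on m I A \<longleftrightarrow> hermitian_mat m A \<and> spectrum A \<subseteq> complex_of_real ` I"

definition matrix_concave :: "nat \<Rightarrow> real set \<Rightarrow> (real \<Rightarrow> real) \<Rightarrow> bool" where
  "matrix_concave m I f \<longleftrightarrow>
     (\<forall>A B. \<forall>l \<in> {0..1::real}. hermitian_on m I A \<longrightarrow> hermitian_on m I B \<longrightarrow>
        loewner_le m
          (complex_of_real l \<cdot>\<^sub>m mat_fun f A + complex_of_real (1 - l) \<cdot>\<^sub>m mat_fun f B)
          (mat_fun f (complex_of_real l \<cdot>\<^sub>m A + complex_of_real (1 - l) \<cdot>\<^sub>m B)))"

definition matrix_monotone :: "nat \<Rightarrow> real set \<Rightarrow> (real \<Rightarrow> real) \<Rightarrow> bool" where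
  "matrix_monotone m I f \<longleftrightarrow>
     (\<forall>A B. hermitian_on m I A \<longrightarrow> hermitian_on m I B \<longrightarrow> loewner_le m A B \<longrightarrow>
        loewner_le m (mat_fun f A) (mat_fun f B))"

definition matrix_contraction_ineq :: "nat \<Rightarrow> real set \<Rightarrow> (real \<Rightarrow> real) \<Rightarrow> bool" where
  "matrix_contraction_ineq m I f \<longleftrightarrow>
     (\<forall>A C. hermitian_on m I A \<longrightarrow> contraction_mat m C \<longrightarrow>
        loewner_le m (mat_adjoint C * mat_fun f A * C) (mat_fun f (mat_adjoint C * A * C)))"

lemma mat_adjoint_carrier: "U \<in> carrier_mat n m \<Longrightarrow> mat_adjoint U \<in> carrier_mat m n"
  unfolding mat_adjoint_def by auto

lemma mat_fun_eqI:
  assumes U: "unitary_mat n U"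
    and A: "A = U * mat_diag n (\<lambda>i. complex_of_real (d i)) * mat_adjoint U"
  shows "mat_fun f A = U * mat_diag n (\<lambda>i. complex_of_real (f (d i))) * mat_adjoint U"
proof -
  have Uc [simp]: "U \<in> carrier_mat n n" "mat_adjoint U \<in> carrier_mat n n"
    using U mat_adjoint_carrier by (auto simp: unitary_mat_def)
  have Ac: "A \<in> carrier_mat n n" using A by (metis Uc mat_diag_dim mult_carrier_mat)
  define D where "D = (\<lambda>d::nat \<Rightarrow> real. mat_diag n (\<lambda>i. complex_of_real (d i)))"
  have Dc [simp]: "D e \<in> carrier_mat n n" for e by (simp add: D_def)
  have uniq: "V * D (f \<circ> e) * mat_adjoint V = U * D (f \<circ> d) * mat_adjoint U"
    if V: "unitary_mat n V" and AV: "A = V * D e * mat_adjoint V" for V e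
  proof -
    have Vc [simp]: "V \<in> carrier_mat n n" "mat_adjoint V \<in> carrier_mat n n"
      using V mat_adjoint_carrier by (auto simp: unitary_mat_def)
    have VV: "mat_adjoint V * V = 1\<^sub>m n" "V * mat_adjoint V = 1\<^sub>m n"
      and UU: "mat_adjoint U * U = 1\<^sub>m n" "U * mat_adjoint U = 1\<^sub>m n"
      using U V by (auto simp: unitary_mat_def)
    define W where "W = mat_adjoint V * U"
    have Wc [simp]: "W \<in> carrier_mat n n" by (metis W_def Uc(1) Vc(2) mult_carrier_mat)
    have c: "X * Y \<in> carrier_mat n n"
      if "X \<in> carrier_mat n n" "Y \<in> carrier_mat n n" for X Y :: "complex mat"
      using that by auto
    have as: "X * Y * Z = X * (Y * Z)"
      if "X \<in> carrier_mat n n" "Y \<in> carrier_mat n n" "Z \<in> carrier_mat n n" for X Y Z :: "complex mat"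
      using that by (rule assoc_mult_mat)
    have canV: "mat_adjoint V * (V * X) = X" "V * (mat_adjoint V * X) = X"
      if "X \<in> carrier_mat n n" for X
      using that VV by (metis Vc as left_mult_one_mat)+
    have "mat_adjoint V * A * U = W * D d"
      unfolding A W_def using UU by (simp add: as c D_def right_mult_one_mat[OF mat_diag_dim])
    moreover have "mat_adjoint V * A * U = D e * W"
      unfolding AV W_def using VV by (simp add: as c canV)
    ultimately have "W * D d = D e * W" by simp
    then have wd: "W $$ (i,j) * d j = e i * W $$ (i,j)" if "i < n" "j < n" for i j
      using that Wc unfolding D_def mat_diag_mult_left[OF Wc] mat_diag_mult_right[OF Wc]
      by (auto dest!: arg_cong[where f = "\<lambda>M. M $$ (i,j)"])
    have "W $$ (i,j) * f (d j) = f (e i) * W $$ (i,j)" if "i < n" "j < n" for i j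
      using wd[OF that] by (cases "W $$ (i,j) = 0") (auto simp: mult.commute)
    then have WD: "W * D (f \<circ> d) = D (f \<circ> e) * W"
      unfolding D_def mat_diag_mult_left[OF Wc] mat_diag_mult_right[OF Wc]
      by (intro eq_matI) auto
    have "U * D (f \<circ> d) * mat_adjoint U = V * (W * D (f \<circ> d)) * mat_adjoint U"
      unfolding W_def by (simp add: as c canV)
    also have "\<dots> = V * D (f \<circ> e) * (mat_adjoint V * (U * mat_adjoint U))"
      unfolding WD unfolding W_def by (simp add: as c)
    also have "\<dots> = V * D (f \<circ> e) * mat_adjoint V"
      by (simp add: UU right_mult_one_mat[OF Vc(2)])
    finally show ?thesis by simp
  qed
  have dim: "dim_row A = n" using Ac by simp
  show ?thesis
    unfolding mat_fun_def dim
  proof (rule the_equality)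
    show "\<exists>V e. unitary_mat n V \<and> A = V * mat_diag n (\<lambda>i. complex_of_real (e i)) * mat_adjoint V \<and>
      U * mat_diag n (\<lambda>i. complex_of_real (f (d i))) * mat_adjoint U =
      V * mat_diag n (\<lambda>i. complex_of_real (f (e i))) * mat_adjoint V"
      using U A by blast
  qed (use uniq in \<open>auto simp: D_def\<close>)
qed

end

theory Submission
  imports Defs
begin

text \<open>
  Everything rests on two ways of moving between contractions and inequalities of matrices.

  First, a functional calculus respects intertwiners: \<open>A W = W B\<close> implies \<open>f(A) W = W f(B)\<close>, also
  for rectangular \<open>W\<close> (lemma \<open>mat_fun_intertwine\<close>). So \<open>f\<close> of a dilation is computed on the
  embedded copy of the small matrix, and \<open>f(Z Z\<^sup>\<dagger>) Z = Z f(Z\<^sup>\<dagger> Z)\<close>. Second, \<open>Z\<^sup>\<dagger> Z \<le> 1\<close> and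
  \<open>Z Z\<^sup>\<dagger> \<le> 1\<close> are equivalent (lemma \<open>loewner_gram_swap\<close>), which makes inversion antitone.

  Call \<open>R\<close> a rank-one contraction if \<open>R\<^sup>2 = 1 - w w\<^sup>\<dagger>\<close> for a vector \<open>w\<close> of length at most one, with
  \<open>R\<close> the positive square root. One extra dimension is enough to dilate such an \<open>R\<close> to unitaries
  \<open>U\<^sub>+\<close> and \<open>U\<^sub>-\<close>. The mean of the two matrices \<open>U\<^sup>\<dagger> (A \<oplus> 0) U\<close> leaves the original space invariant
  and acts there as \<open>R A R\<close>, so midpoint concavity in dimension \<open>n + 1\<close> together with \<open>f(0) \<ge> 0\<close>
  gives \<open>R f(A) R \<le> f(R A R)\<close> in dimension \<open>n\<close> (lemma \<open>concave_imp_rank_one\<close>). A general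
  contraction would need up to \<open>n\<close> extra dimensions.

  Rank-one contractions already force monotonicity of \<open>g(t) = t / f(t)\<close> (lemma
  \<open>rank_one_imp_monotone\<close>): by the spectral theorem \<open>B - A\<close> is a sum of rank-one matrices \<open>x x\<^sup>\<dagger>\<close>,
  and if \<open>A = B - x x\<^sup>\<dagger>\<close>, then \<open>A = B\<^bsup>1/2\<^esup> (1 - w w\<^sup>\<dagger>) B\<^bsup>1/2\<^esup>\<close> with \<open>w = B\<^bsup>-1/2\<^esup> x\<close>. With
  \<open>Z = B\<^bsup>1/2\<^esup> R\<close> the matrices \<open>A = Z Z\<^sup>\<dagger>\<close> and \<open>R B R = Z\<^sup>\<dagger> Z\<close> are intertwined, and the rank-one
  inequality for \<open>B\<close> turns into \<open>f(B) B\<^sup>-\<^sup>1 \<le> f(A) A\<^sup>-\<^sup>1\<close>.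

  Conversely, let \<open>g\<close> be monotone, \<open>A > 0\<close> and \<open>C\<close> any contraction. With \<open>Z = A\<^bsup>1/2\<^esup> C\<close> one has
  \<open>Z Z\<^sup>\<dagger> \<le> A\<close>, and \<open>g(Z Z\<^sup>\<dagger>) \<le> g(A)\<close> reads \<open>C f(C\<^sup>\<dagger> A C)\<^sup>-\<^sup>1 C\<^sup>\<dagger> \<le> f(A)\<^sup>-\<^sup>1\<close> after \<open>A\<^bsup>1/2\<^esup>\<close> is
  cancelled; swapping the Gram matrix yields \<open>C\<^sup>\<dagger> f(A) C \<le> f(C\<^sup>\<dagger> A C)\<close>. Singular matrices are
  reached by the limit \<open>A + \<epsilon> 1\<close>, for which the functional calculus of a continuous function is
  shown to be continuous (lemma \<open>mat_fun_tendsto\<close>). Hence concavity in dimension \<open>n + 1\<close> gives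
  the full contraction inequality by way of the monotonicity of \<open>g\<close>.

  Concavity in half the dimension is the compression of \<open>A \<oplus> B\<close> by the isometry
  \<open>\<surd>\<lambda> J + \<surd>(1 - \<lambda>) L\<close>, where \<open>J\<close> and \<open>L\<close> are the two coordinate embeddings (lemma
  \<open>contraction_ineq_imp_concave\<close>).

  Finally, \<open>f\<close> has constant sign, as it has no zero. Under the contraction inequality it
  is positive, as the contraction \<open>0\<close> shows \<open>f(0) \<ge> 0\<close>. It is also positive if \<open>g\<close> is monotone,
  since a negative \<open>f\<close> would make \<open>g\<close> negative with \<open>g(t) \<rightarrow> 0\<close> as \<open>t \<rightarrow> 0\<close>, against monotonicity
  on scalar matrices.
\<close>

section \<open>Matrix algebra and adjoints\<close>

notation mat_adjoint ("_\<^sup>\<dagger>" [1000] 1000)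

lemma dim_mat_adjoint [simp]: "dim_row (A\<^sup>\<dagger>) = dim_col A" "dim_col (A\<^sup>\<dagger>) = dim_row A"
  by (auto simp: mat_adjoint_def)

lemma index_mat_adjoint [simp]:
  "i < dim_col A \<Longrightarrow> j < dim_row A \<Longrightarrow> (A\<^sup>\<dagger>) $$ (i,j) = cnj (A $$ (j,i))"
  by (simp add: mat_adjoint_def mat_of_rows_def)

text \<open>
  The library states the ring laws for matrices with carrier assumptions, whose inner dimension the
  simplifier cannot guess. In terms of \<open>dim_row\<close> and \<open>dim_col\<close> they become usable conditional
  rewrite rules, collected below as \<open>mat_expand\<close>.
\<close>

lemma mult_assoc_dim:
  "dim_col A = dim_row B \<Longrightarrow> dim_col B = dim_row C \<Longrightarrow> (A * B) * C = A * (B * (C :: complex mat))"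
  by (rule assoc_mult_mat[of _ "dim_row A" "dim_col A" _ "dim_col B" _ "dim_col C"]) auto

lemma add_mult_dim:
  "dim_row A = dim_row B \<Longrightarrow> dim_col A = dim_col B \<Longrightarrow> dim_col B = dim_row C \<Longrightarrow>
    (A + B) * C = A * C + B * (C :: complex mat)"
  by (rule add_mult_distrib_mat[of _ "dim_row A" "dim_col A" _ _ "dim_col C"]) auto

lemma mult_add_dim:
  "dim_row B = dim_row C \<Longrightarrow> dim_col B = dim_col C \<Longrightarrow> dim_col A = dim_row B \<Longrightarrow>
    A * (B + C) = A * B + A * (C :: complex mat)"
  by (rule mult_add_distrib_mat[of _ "dim_row A" "dim_col A" _ "dim_col C"]) auto

lemma minus_mult_dim:
  "dim_row A = dim_row B \<Longrightarrow> dim_col A = dim_col B \<Longrightarrow> dim_col B = dim_row C \<Longrightarrow>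
    (A - B) * C = A * C - B * (C :: complex mat)"
  by (rule minus_mult_distrib_mat[of _ "dim_row A" "dim_col A" _ _ "dim_col C"]) auto

lemma mult_minus_dim:
  "dim_row B = dim_row C \<Longrightarrow> dim_col B = dim_col C \<Longrightarrow> dim_col A = dim_row B \<Longrightarrow>
    A * (B - C) = A * B - A * (C :: complex mat)"
  by (rule mult_minus_distrib_mat[of _ "dim_row A" "dim_col A" _ "dim_col C"]) auto

lemma smult_mult_dim:
  "dim_col A = dim_row B \<Longrightarrow> (k \<cdot>\<^sub>m A) * B = k \<cdot>\<^sub>m (A * (B :: complex mat))"
  by (rule mult_smult_assoc_mat[of _ "dim_row A" "dim_col A" _ "dim_col B"]) auto

lemma mult_smult_dim:
  "dim_col A = dim_row B \<Longrightarrow> A * (k \<cdot>\<^sub>m B) = k \<cdot>\<^sub>m (A * (B :: complex mat))"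
  by (rule mult_smult_distrib[of _ "dim_row A" "dim_col A" _ "dim_col B"]) auto

lemma one_mult_dim: "dim_row A = n \<Longrightarrow> 1\<^sub>m n * A = (A :: complex mat)"
  and mult_one_dim: "dim_col A = n \<Longrightarrow> A * 1\<^sub>m n = (A :: complex mat)"
  by (auto intro: left_mult_one_mat'[of _ "dim_row A"])

lemma zero_mult_dim: "dim_row A = n \<Longrightarrow> 0\<^sub>m k n * A = (0\<^sub>m k (dim_col A) :: complex mat)"
  and mult_zero_dim: "dim_col A = n \<Longrightarrow> A * 0\<^sub>m n k = (0\<^sub>m (dim_row A) k :: complex mat)"
  by (intro eq_matI; simp)+

lemma smult_smult_dim: "a \<cdot>\<^sub>m (b \<cdot>\<^sub>m A) = (a * b) \<cdot>\<^sub>m (A :: complex mat)"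
  by (intro eq_matI) auto

lemmas mat_expand = mult_assoc_dim add_mult_dim mult_add_dim minus_mult_dim mult_minus_dim
  smult_mult_dim mult_smult_dim one_mult_dim mult_one_dim zero_mult_dim mult_zero_dim smult_smult_dim

lemma adjoint_mult: "dim_col A = dim_row B \<Longrightarrow> (A * B)\<^sup>\<dagger> = B\<^sup>\<dagger> * (A :: complex mat)\<^sup>\<dagger>"
  by (rule eq_matI) (auto simp: scalar_prod_def intro!: sum.cong)

lemma adjoint_add: "dim_row A = dim_row B \<Longrightarrow> dim_col A = dim_col B \<Longrightarrow> (A + B)\<^sup>\<dagger> = (A :: complex mat)\<^sup>\<dagger> + B\<^sup>\<dagger>"
  and adjoint_minus: "dim_row A = dim_row B \<Longrightarrow> dim_col A = dim_col B \<Longrightarrow> (A - B)\<^sup>\<dagger> = (A :: complex mat)\<^sup>\<dagger> - B\<^sup>\<dagger>"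
  and adjoint_smult: "(c \<cdot>\<^sub>m A)\<^sup>\<dagger> = cnj c \<cdot>\<^sub>m (A :: complex mat)\<^sup>\<dagger>"
  and adjoint_adjoint: "A\<^sup>\<dagger>\<^sup>\<dagger> = (A :: complex mat)"
  and adjoint_one: "(1\<^sub>m n)\<^sup>\<dagger> = (1\<^sub>m n :: complex mat)"
  and adjoint_zero: "(0\<^sub>m n k)\<^sup>\<dagger> = (0\<^sub>m k n :: complex mat)"
  by (rule eq_matI; auto)+

lemmas adjoint_simps [simp] =
  adjoint_mult adjoint_add adjoint_minus adjoint_smult adjoint_adjoint adjoint_one adjoint_zero

abbreviation real_diag :: "nat \<Rightarrow> (nat \<Rightarrow> real) \<Rightarrow> complex mat" where
  "real_diag m d \<equiv> mat_diag m (\<lambda>i. complex_of_real (d i))"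

lemma dim_mat_diag [simp]: "dim_row (mat_diag m d) = m" "dim_col (mat_diag m d) = m"
  by (auto simp: mat_diag_def)

lemma adjoint_real_diag [simp]: "(real_diag m d)\<^sup>\<dagger> = real_diag m d"
  by (rule eq_matI) (auto simp: mat_diag_def)

lemma hermitian_mat_dim:
  assumes "hermitian_mat m A"
  shows "dim_row A = m" "dim_col A = m" "A\<^sup>\<dagger> = A"
  using assms by (auto simp: hermitian_mat_def)

lemma hermitian_matI: "dim_row A = m \<Longrightarrow> dim_col A = m \<Longrightarrow> A\<^sup>\<dagger> = A \<Longrightarrow> hermitian_mat m A"
  by (auto simp: hermitian_mat_def)

lemma unitary_mat_dim:
  assumes "unitary_mat m U"
  shows "dim_row U = m" "dim_col U = m" "U\<^sup>\<dagger> * U = 1\<^sub>m m" "U * U\<^sup>\<dagger> = 1\<^sub>m m"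
  using assms by (auto simp: unitary_mat_def)

lemma mult_cancel_dim:
  assumes "A * B = 1\<^sub>m m" "dim_col A = dim_row B" "dim_col B = dim_row C"
  shows "A * (B * C) = (C :: complex mat)"
proof -
  have "dim_col B = m" using assms(1) by (metis index_mult_mat(3) index_one_mat(3))
  then show ?thesis using assms by (simp flip: mult_assoc_dim add: one_mult_dim)
qed

lemma unitary_mat_mult:
  assumes "unitary_mat m U" "unitary_mat m V"
  shows "unitary_mat m (U * V)"
proof -
  note [simp] = unitary_mat_dim[OF assms(1)] unitary_mat_dim[OF assms(2)]
  show ?thesis unfolding unitary_mat_def
    by (auto simp: mat_expand intro!: carrier_matI mult_cancel_dim[of _ _ m]
        simp: mult_cancel_dim[of U "U\<^sup>\<dagger>" m] mult_cancel_dim[of "U\<^sup>\<dagger>" U m]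
          mult_cancel_dim[of V "V\<^sup>\<dagger>" m] mult_cancel_dim[of "V\<^sup>\<dagger>" V m])
qed

lemma hermitian_congruence:
  assumes "hermitian_mat m A" "dim_row C = m" "dim_col C = k"
  shows "hermitian_mat k (C\<^sup>\<dagger> * A * C)"
  using assms hermitian_mat_dim[OF assms(1)]
  by (intro hermitian_matI) (auto simp: mat_expand)

section \<open>Spectral theorem\<close>

lemma smult_cancel_dim:
  assumes "A * B = s \<cdot>\<^sub>m 1\<^sub>m m" "dim_col A = dim_row B" "dim_col B = dim_row C"
  shows "A * (B * C) = s \<cdot>\<^sub>m (C :: complex mat)"
proof -
  have "dim_col B = m" using assms(1) by (metis index_mult_mat(3) index_smult_mat(3) index_one_mat(3))
  then show ?thesis using assms by (simp flip: mult_assoc_dim add: smult_mult_dim one_mult_dim)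
qed

lemma zero_cancel_dim:
  assumes "A * B = 0\<^sub>m k m" "dim_col A = dim_row B" "dim_col B = dim_row C"
  shows "A * (B * C) = (0\<^sub>m k (dim_col C) :: complex mat)"
proof -
  have "dim_col B = m" using assms(1) by (metis index_mult_mat(3) index_zero_mat(3))
  then show ?thesis using assms by (simp flip: mult_assoc_dim add: zero_mult_dim)
qed

text \<open>
  The \<open>k\<close>-th coordinate embedding of \<open>\<complex>\<^sup>m\<close> into \<open>\<complex>\<^sup>n\<close>. It covers block inclusions as well as unit
  vectors (\<open>m = 1\<close>), so that direct sums and columns need no block matrices.
\<close>

definition embed :: "nat \<Rightarrow> nat \<Rightarrow> nat \<Rightarrow> complex mat" where
  "embed n m k = mat n m (\<lambda>(i,j). if i = j + k then 1 else 0)"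

lemma dim_embed [simp]: "dim_row (embed n m k) = n" "dim_col (embed n m k) = m"
  by (auto simp: embed_def)

lemma index_embed: "i < n \<Longrightarrow> j < m \<Longrightarrow> embed n m k $$ (i,j) = (if i = j + k then 1 else 0)"
  by (simp add: embed_def)

lemma index_embed_mult:
  assumes "dim_row X = m" "i < n" "j < dim_col X"
  shows "(embed n m k * X) $$ (i,j) = (if k \<le> i \<and> i < k + m then X $$ (i - k, j) else 0)"
proof -
  have "(embed n m k * X) $$ (i,j) = (\<Sum>l<m. (if i = l + k then 1 else 0) * X $$ (l,j))"
    using assms by (simp add: embed_def scalar_prod_def lessThan_atLeast0)
  also have "\<dots> = (\<Sum>l<m. if l = i - k then (if k \<le> i then X $$ (l,j) else 0) else 0)"
    by (rule sum.cong) auto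
  also have "\<dots> = (if k \<le> i \<and> i < k + m then X $$ (i - k, j) else 0)" by auto
  finally show ?thesis .
qed

lemma index_adjoint_embed_mult:
  assumes "dim_row X = n" "k + m \<le> n" "i < m" "j < dim_col X"
  shows "((embed n m k)\<^sup>\<dagger> * X) $$ (i,j) = X $$ (i + k, j)"
proof -
  have "((embed n m k)\<^sup>\<dagger> * X) $$ (i,j) = (\<Sum>l<n. cnj (if l = i + k then 1 else 0) * X $$ (l,j))"
    using assms by (simp add: embed_def scalar_prod_def lessThan_atLeast0)
  also have "\<dots> = (\<Sum>l<n. if l = i + k then X $$ (l,j) else 0)"
    by (rule sum.cong) auto
  also have "\<dots> = X $$ (i + k, j)" using assms by simp
  finally show ?thesis .
qed

lemma index_mult_adjoint_embed:
  assumes "dim_col X = m" "i < dim_row X" "j < n"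
  shows "(X * (embed n m k)\<^sup>\<dagger>) $$ (i,j) = (if k \<le> j \<and> j < k + m then X $$ (i, j - k) else 0)"
proof -
  have "X * (embed n m k)\<^sup>\<dagger> = (embed n m k * X\<^sup>\<dagger>)\<^sup>\<dagger>" using assms by simp
  also have "\<dots> $$ (i,j) = cnj ((embed n m k * X\<^sup>\<dagger>) $$ (j,i))" using assms by (subst index_mat_adjoint) auto
  also have "(embed n m k * X\<^sup>\<dagger>) $$ (j,i) = (if k \<le> j \<and> j < k + m then X\<^sup>\<dagger> $$ (j - k, i) else 0)"
    using assms by (intro index_embed_mult) auto
  finally show ?thesis using assms by auto
qed

lemma embed_isometry: "k + m \<le> n \<Longrightarrow> (embed n m k)\<^sup>\<dagger> * embed n m k = 1\<^sub>m m"
  by (rule eq_matI) (auto simp: index_adjoint_embed_mult index_embed simp del: index_mult_mat(1))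

lemma embed_orthogonal: "k + m \<le> n \<Longrightarrow> l + p \<le> n \<Longrightarrow> k + m \<le> l \<or> l + p \<le> k \<Longrightarrow>
    (embed n m k)\<^sup>\<dagger> * embed n p l = 0\<^sub>m m p"
  by (rule eq_matI) (auto simp: index_adjoint_embed_mult index_embed simp del: index_mult_mat(1))

text \<open>
  The decomposition \<open>\<complex>\<^bsup>n+1\<^esup> = \<complex> \<oplus> \<complex>\<^sup>n\<close>, used to peel off an eigenvector in the spectral theorem and
  for the extra dimension of the dilation.
\<close>

lemma embed_resolution:
  "embed (Suc n) 1 0 * (embed (Suc n) 1 0)\<^sup>\<dagger> + embed (Suc n) n 1 * (embed (Suc n) n 1)\<^sup>\<dagger> = 1\<^sub>m (Suc n)"
  by (rule eq_matI) (auto simp: index_embed_mult index_embed simp del: index_mult_mat(1))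

text \<open>
  Vectors are kept as matrices with one column. The phase of the eigenvector is chosen such that its
  first entry is real and at most \<open>0\<close>, which is what the following Householder reflection needs.
\<close>

lemma unit_eigenvector_exists:
  assumes A: "A \<in> carrier_mat m m" and m: "m > 0"
  obtains v k r where "dim_row v = m" "dim_col v = 1" "v\<^sup>\<dagger> * v = 1\<^sub>m 1" "A * v = k \<cdot>\<^sub>m v"
    "v $$ (0,0) = complex_of_real r" "r \<le> 0"
proof -
  obtain k u where u: "u \<in> carrier_vec m" "u \<noteq> 0\<^sub>v m" "A *\<^sub>v u = k \<cdot>\<^sub>v u"
    using spectrum_non_empty[OF A m] A unfolding spectrum_def eigenvalue_def eigenvector_def by auto
  define N where "N = (\<Sum>i<m. (cmod (u $ i))\<^sup>2)"
  have "\<exists>i<m. u $ i \<noteq> 0" using u by (auto simp: vec_eq_iff)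
  then have N: "N > 0" unfolding N_def by (auto intro!: sum_pos2)
  define c where "c = (if u $ 0 = 0 then 1 else - cnj (u $ 0) / cmod (u $ 0))"
  have n0: "cnj (u $ 0) * (u $ 0) = complex_of_real (cmod (u $ 0)) * complex_of_real (cmod (u $ 0))"
    by (metis complex_norm_square mult.commute of_real_power power2_eq_square)
  have c: "cnj c * c = 1" using n0 by (auto simp: c_def divide_simps mult.commute)
  have c0: "c * u $ 0 = - complex_of_real (cmod (u $ 0))" using n0 by (auto simp: c_def divide_simps)
  have sq: "complex_of_real (sqrt N) * complex_of_real (sqrt N) = complex_of_real N"
    using N by (simp flip: of_real_mult)
  define v where "v = mat m 1 (\<lambda>(i,j). c / sqrt N * u $ i)"
  have [simp]: "dim_row v = m" "dim_col v = 1" "dim_row A = m" "dim_col A = m" using A by (auto simp: v_def)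
  show ?thesis
  proof (rule that[of v k "- cmod (u $ 0) / sqrt N"])
    show "v\<^sup>\<dagger> * v = 1\<^sub>m 1"
    proof (rule eq_matI; clarsimp)
      have "(\<Sum>i<m. cnj (v $$ (i,0)) * v $$ (i,0)) = (\<Sum>i<m. (cmod (u $ i))\<^sup>2 / N)"
        unfolding of_real_sum
      proof (rule sum.cong; clarsimp)
        fix i assume i: "i < m"
        have "cnj (v $$ (i, 0)) * v $$ (i, 0) = (cnj c * c) * (cnj (u $ i) * u $ i) / complex_of_real N"
          using i sq by (simp add: v_def algebra_simps)
        then show "cnj (v $$ (i, 0)) * v $$ (i, 0) = (complex_of_real (cmod (u $ i)))\<^sup>2 / complex_of_real N"
          using c complex_norm_square[of "u $ i"] by (simp add: mult.commute)
      qed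
      also have "\<dots> = 1" using N by (simp add: N_def flip: sum_divide_distrib)
      finally show "row (v\<^sup>\<dagger>) 0 \<bullet> col v 0 = 1"
        by (simp add: scalar_prod_def lessThan_atLeast0)
    qed
    show "A * v = k \<cdot>\<^sub>m v"
    proof (rule eq_matI; clarsimp)
      fix i assume i: "i < m"
      have "(\<Sum>l<m. A $$ (i,l) * u $ l) = (A *\<^sub>v u) $ i"
        using A u(1) i by (simp add: scalar_prod_def lessThan_atLeast0)
      also have "\<dots> = k * u $ i" unfolding u(3) using u(1) i by simp
      finally have Au: "(\<Sum>l<m. A $$ (i,l) * u $ l) = k * u $ i" .
      have "row A i \<bullet> col v 0 = (\<Sum>l<m. c / sqrt N * (A $$ (i,l) * u $ l))"
        using A u i by (auto simp: scalar_prod_def lessThan_atLeast0 v_def intro!: sum.cong)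
      also have "\<dots> = c / sqrt N * (\<Sum>l<m. A $$ (i,l) * u $ l)" by (rule sum_distrib_left[symmetric])
      finally have "row A i \<bullet> col v 0 = c / sqrt N * (k * u $ i)" unfolding Au .
      then show "row A i \<bullet> col v 0 = k * v $$ (i, 0)" using i by (simp add: v_def)
    qed
    show "v $$ (0,0) = complex_of_real (- cmod (u $ 0) / sqrt N)" using m c0 by (simp add: v_def)
    show "- cmod (u $ 0) / sqrt N \<le> 0" using N by simp
  qed auto
qed

text \<open>
  The Householder reflection along \<open>x = e - v\<close> swaps \<open>e\<close> and \<open>v\<close>. It needs \<open>v\<^sup>\<dagger> e\<close> real; since
  \<open>v\<^sub>0 \<le> 0\<close>, the length \<open>x\<^sup>\<dagger> x = 2 (1 - v\<^sub>0)\<close> is not zero.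
\<close>

lemma unitary_first_column_exists:
  assumes v: "dim_row v = Suc m" "dim_col v = 1" "v\<^sup>\<dagger> * v = 1\<^sub>m 1"
    and r: "v $$ (0,0) = complex_of_real r" "r \<le> 0"
  obtains H where "unitary_mat (Suc m) H" "H * embed (Suc m) 1 0 = v" "H * v = embed (Suc m) 1 0"
    "H\<^sup>\<dagger> = H"
proof -
  define e where "e = embed (Suc m) 1 0"
  have [simp]: "dim_row e = Suc m" "dim_col e = 1" by (auto simp: e_def)
  have ee: "e\<^sup>\<dagger> * e = 1\<^sub>m 1" unfolding e_def by (rule embed_isometry) simp
  have ev: "e\<^sup>\<dagger> * v = complex_of_real r \<cdot>\<^sub>m 1\<^sub>m 1"
    by (rule eq_matI) (use v r in \<open>auto simp: e_def index_adjoint_embed_mult simp del: index_mult_mat(1)\<close>)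
  have ve: "v\<^sup>\<dagger> * e = complex_of_real r \<cdot>\<^sub>m 1\<^sub>m 1"
    using arg_cong[OF ev, of mat_adjoint] v by simp
  define t where "t = 1 / complex_of_real (1 - r)"
  have t: "t * (1 - complex_of_real r) = 1" "cnj t = t" using r by (auto simp: t_def)
  define x where "x = e - v"
  have [simp]: "dim_row x = Suc m" "dim_col x = 1" using v by (auto simp: x_def)
  define H where "H = 1\<^sub>m (Suc m) - t \<cdot>\<^sub>m (x * x\<^sup>\<dagger>)"
  have [simp]: "dim_row H = Suc m" "dim_col H = Suc m" by (auto simp: H_def)
  have adj: "H\<^sup>\<dagger> = H" using t by (simp add: H_def)
  have xe: "x\<^sup>\<dagger> * e = (1 - complex_of_real r) \<cdot>\<^sub>m 1\<^sub>m 1" and xv: "x\<^sup>\<dagger> * v = (complex_of_real r - 1) \<cdot>\<^sub>m 1\<^sub>m 1"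
    unfolding x_def using v by (auto simp: mat_expand ee ev ve v(3) intro!: eq_matI)
  have He: "H * e = v"
    unfolding H_def by (simp add: mat_expand xe t) (auto simp: x_def v intro!: eq_matI)
  have "t * (complex_of_real r - 1) = - (t * (1 - complex_of_real r))" by (simp add: algebra_simps)
  also have "\<dots> = - 1" by (simp only: t)
  finally have Hv: "H * v = e"
    unfolding H_def using v by (simp add: mat_expand xv) (auto simp: x_def v intro!: eq_matI)
  have Hx: "H * x = - 1 \<cdot>\<^sub>m x" unfolding x_def using v by (auto simp: mat_expand He Hv intro!: eq_matI)
  have "H * H = 1\<^sub>m (Suc m)"
  proof -
    have "H * H = H - t \<cdot>\<^sub>m ((H * x) * x\<^sup>\<dagger>)" 
      by (subst (2) H_def) (simp add: mat_expand)
    also have "\<dots> = H + t \<cdot>\<^sub>m (x * x\<^sup>\<dagger>)"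
      unfolding Hx by (auto simp: mat_expand simp del: index_mult_mat(1) intro!: eq_matI)
    finally show ?thesis by (simp add: H_def) (auto simp del: index_mult_mat(1) intro!: eq_matI)
  qed
  then show ?thesis using adj He Hv
    by (intro that[of H]) (auto simp: unitary_mat_def e_def intro!: carrier_matI)
qed

lemma diag_decomposition:
  "real_diag (Suc m) (case_nat l d) =
    complex_of_real l \<cdot>\<^sub>m (embed (Suc m) 1 0 * (embed (Suc m) 1 0)\<^sup>\<dagger>) +
    embed (Suc m) m 1 * real_diag m d * (embed (Suc m) m 1)\<^sup>\<dagger>"
  by (rule eq_matI)
    (auto simp: mult_assoc_dim index_embed_mult index_mult_adjoint_embed index_embed mat_diag_def
      simp del: index_mult_mat(1) split: nat.splits)

text \<open>
  Induction on the dimension: after a Householder reflection that sends \<open>e\<close> to a unit eigenvector,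
  \<open>e\<close> is an eigenvector of \<open>B = H A H\<close>, and self-adjointness makes the complement of \<open>e\<close> invariant.
\<close>

lemma spectral_theorem:
  assumes "hermitian_mat m A"
  obtains U d where "unitary_mat m U" "A = U * real_diag m d * U\<^sup>\<dagger>"
proof -
  have "\<exists>U d. unitary_mat m U \<and> A = U * real_diag m d * U\<^sup>\<dagger>"
    using assms
  proof (induction m arbitrary: A)
    case 0
    show ?case
      by (rule exI[of _ "1\<^sub>m 0"]) (use 0 in \<open>auto simp: unitary_mat_def hermitian_mat_def intro!: eq_matI\<close>)
  next
    case (Suc m)
    note [simp] = hermitian_mat_dim[OF Suc.prems]
    obtain v k r where v: "dim_row v = Suc m" "dim_col v = 1" "v\<^sup>\<dagger> * v = 1\<^sub>m 1" "A * v = k \<cdot>\<^sub>m v"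
      "v $$ (0,0) = complex_of_real r" "r \<le> 0"
      using Suc.prems unit_eigenvector_exists[of A "Suc m"] unfolding hermitian_mat_def by blast
    define e where "e = embed (Suc m) 1 0"
    define J where "J = embed (Suc m) m 1"
    obtain H where H: "unitary_mat (Suc m) H" "H * e = v" "H * v = e" "H\<^sup>\<dagger> = H"
      using unitary_first_column_exists[OF v(1,2,3,5,6)] unfolding e_def by blast
    have HH: "H * H = 1\<^sub>m (Suc m)" using H by (auto simp: unitary_mat_def)
    have [simp]: "dim_row H = Suc m" "dim_col H = Suc m" using unitary_mat_dim[OF H(1)] by auto
    have [simp]: "dim_row e = Suc m" "dim_col e = 1" "dim_row J = Suc m" "dim_col J = m"
      by (auto simp: e_def J_def)
    have ee: "e\<^sup>\<dagger> * e = 1\<^sub>m 1" and JJ: "J\<^sup>\<dagger> * J = 1\<^sub>m m" and eJ: "e\<^sup>\<dagger> * J = 0\<^sub>m 1 m" and Je: "J\<^sup>\<dagger> * e = 0\<^sub>m m 1"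
      unfolding e_def J_def by (auto intro!: embed_isometry embed_orthogonal)
    have res: "e * e\<^sup>\<dagger> + J * J\<^sup>\<dagger> = 1\<^sub>m (Suc m)" unfolding e_def J_def by (rule embed_resolution)
    define B where "B = H * A * H"
    have [simp]: "dim_row B = Suc m" "dim_col B = Suc m" "B\<^sup>\<dagger> = B" by (auto simp: B_def H mat_expand)
    have Be: "B * e = k \<cdot>\<^sub>m e" by (simp add: B_def mat_expand H v)
    have eB: "e\<^sup>\<dagger> * B = cnj k \<cdot>\<^sub>m e\<^sup>\<dagger>" using arg_cong[OF Be, of mat_adjoint] by simp
    have "k \<cdot>\<^sub>m 1\<^sub>m 1 = e\<^sup>\<dagger> * (B * e)" unfolding Be by (simp add: mat_expand ee)
    also have "\<dots> = (e\<^sup>\<dagger> * B) * e" by (simp add: mat_expand)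
    also have "\<dots> = cnj k \<cdot>\<^sub>m 1\<^sub>m 1" unfolding eB by (simp add: mat_expand ee)
    finally have "cnj k = k" by (auto dest!: arg_cong[where f = "\<lambda>M. M $$ (0,0)"])
    then obtain l where k: "k = complex_of_real l" by (metis Reals_cnj_iff Reals_cases)
    have "hermitian_mat m (J\<^sup>\<dagger> * B * J)"
      by (rule hermitian_congruence[of "Suc m"]) (auto intro: hermitian_matI)
    then obtain U d where U: "unitary_mat m U" and Bd: "J\<^sup>\<dagger> * B * J = U * real_diag m d * U\<^sup>\<dagger>"
      using Suc.IH by blast
    note [simp] = unitary_mat_dim[OF U]
    \<comment> \<open>the block of \<open>B\<close> from the complement to \<open>e\<close> vanishes, because \<open>B = B\<^sup>\<dagger>\<close> and \<open>B e = k e\<close>\<close>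
    have BJ: "B * J = J * (J\<^sup>\<dagger> * B * J)"
    proof -
      have "B * J = (e * e\<^sup>\<dagger> + J * J\<^sup>\<dagger>) * (B * J)" unfolding res by (simp add: one_mult_dim)
      also have "\<dots> = e * ((e\<^sup>\<dagger> * B) * J) + J * (J\<^sup>\<dagger> * B * J)" by (simp add: mat_expand)
      also have "e * ((e\<^sup>\<dagger> * B) * J) = 0\<^sub>m (Suc m) m" unfolding eB by (simp add: mat_expand eJ)
      finally show ?thesis by (simp add: left_add_zero_mat[of _ "Suc m" m] carrier_matI)
    qed
    have B: "B = k \<cdot>\<^sub>m (e * e\<^sup>\<dagger>) + J * (U * real_diag m d * U\<^sup>\<dagger>) * J\<^sup>\<dagger>"
    proof -
      have "B = B * (e * e\<^sup>\<dagger> + J * J\<^sup>\<dagger>)" unfolding res by (simp add: mult_one_dim)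
      also have "\<dots> = (B * e) * e\<^sup>\<dagger> + (B * J) * J\<^sup>\<dagger>" by (simp add: mat_expand)
      also have "\<dots> = k \<cdot>\<^sub>m (e * e\<^sup>\<dagger>) + J * (J\<^sup>\<dagger> * B * J) * J\<^sup>\<dagger>" unfolding Be BJ by (simp add: mat_expand)
      finally show ?thesis unfolding Bd .
    qed
    define V where "V = e * e\<^sup>\<dagger> + J * U * J\<^sup>\<dagger>"
    have [simp]: "dim_row V = Suc m" "dim_col V = Suc m" by (auto simp: V_def)
    note canc = mult_cancel_dim[OF ee] mult_cancel_dim[OF JJ] zero_cancel_dim[OF eJ] zero_cancel_dim[OF Je]
      mult_cancel_dim[of U "U\<^sup>\<dagger>" m] mult_cancel_dim[of "U\<^sup>\<dagger>" U m]
    have zero: "X + 0\<^sub>m (Suc m) (Suc m) = X" "0\<^sub>m (Suc m) (Suc m) + X = X"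
      if "dim_row X = Suc m" "dim_col X = Suc m" for X :: "complex mat" using that by (auto intro!: eq_matI)
    have "unitary_mat (Suc m) V"
      unfolding unitary_mat_def V_def using res
      by (auto simp: mat_expand canc ee JJ eJ Je zero intro!: carrier_matI)
    moreover have "V * real_diag (Suc m) (case_nat l d) * V\<^sup>\<dagger> = B"
      unfolding diag_decomposition B V_def k
      unfolding e_def[symmetric] J_def[symmetric] by (simp add: mat_expand canc ee JJ eJ Je zero)
    moreover have "A = H * B * H" by (simp add: B_def mat_expand mult_cancel_dim[OF HH] HH)
    ultimately show ?case using H
      by (intro exI[of _ "H * V"] exI[of _ "case_nat l d"] conjI unitary_mat_mult) (auto simp: mat_expand)
  qed
  then show thesis using that by blast
qed

section \<open>Quadratic forms, Loewner order and functional calculus\<close>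

text \<open>
  The quadratic form at the column \<open>x\<close>. Taking columns as matrices makes a congruence \<open>C\<^sup>\<dagger> A C\<close> a
  mere change of argument.
\<close>

definition qf :: "complex mat \<Rightarrow> complex mat \<Rightarrow> real" where
  "qf A x = Re ((x\<^sup>\<dagger> * (A * x)) $$ (0,0))"

definition column :: "complex vec \<Rightarrow> complex mat" where
  "column v = mat (dim_vec v) 1 (\<lambda>(i,j). v $ i)"

lemma dim_column [simp]: "dim_row (column v) = dim_vec v" "dim_col (column v) = 1"
  by (auto simp: column_def)

lemma column_mult: "dim_vec v = dim_col A \<Longrightarrow> column (A *\<^sub>v v) = A * column v"
  by (rule eq_matI) (auto simp: column_def scalar_prod_def)

lemma column_col: "dim_col x = 1 \<Longrightarrow> column (col x 0) = x"
  by (rule eq_matI) (auto simp: column_def)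

lemma column_smult: "column (c \<cdot>\<^sub>v v) = c \<cdot>\<^sub>m column v"
  by (rule eq_matI) (auto simp: column_def)

lemma cscalar_prod_column:
  assumes "dim_vec v = m" "dim_row A = m" "dim_col A = m"
  shows "(A *\<^sub>v v) \<bullet>c v = ((column v)\<^sup>\<dagger> * (A * column v)) $$ (0,0)"
proof -
  have "((column v)\<^sup>\<dagger> * (A * column v)) $$ (0,0) = ((column v)\<^sup>\<dagger> * column (A *\<^sub>v v)) $$ (0,0)"
    using assms by (simp add: column_mult)
  then show ?thesis using assms by (simp add: scalar_prod_def column_def mult.commute)
qed

lemma form_real:
  assumes "hermitian_mat m A" "dim_row x = m" "dim_col x = 1"
  shows "(x\<^sup>\<dagger> * (A * x)) $$ (0,0) = complex_of_real (qf A x)"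
proof -
  note [simp] = hermitian_mat_dim[OF assms(1)]
  define z where "z = x\<^sup>\<dagger> * (A * x)"
  have [simp]: "dim_row z = 1" "dim_col z = 1" using assms by (auto simp: z_def)
  have "z\<^sup>\<dagger> = z" using assms by (simp add: z_def mat_expand)
  then have "cnj (z $$ (0,0)) = z $$ (0,0)" using index_mat_adjoint[of 0 z 0] by simp
  then show ?thesis unfolding qf_def z_def[symmetric] by (simp add: complex_eq_iff)
qed

lemma psd_mat_iff:
  "psd_mat m A \<longleftrightarrow> hermitian_mat m A \<and> (\<forall>x. dim_row x = m \<longrightarrow> dim_col x = 1 \<longrightarrow> 0 \<le> qf A x)"
proof (cases "hermitian_mat m A")
  case True
  note [simp] = hermitian_mat_dim[OF True]
  have eq: "0 \<le> (A *\<^sub>v v) \<bullet>c v \<longleftrightarrow> 0 \<le> qf A (column v)" if "dim_vec v = m" for v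
    using that form_real[OF True, of "column v"] by (simp add: cscalar_prod_column[of v m] less_eq_complex_def del: index_mult_mat(1))
  show ?thesis
  proof (intro iffI conjI allI impI)
    fix x :: "complex mat" assume p: "psd_mat m A" and x: "dim_row x = m" "dim_col x = 1"
    then show "0 \<le> qf A x" using eq[of "col x 0"] unfolding psd_mat_def by (auto simp: column_col)
  qed (use eq in \<open>auto simp: psd_mat_def\<close>)
qed (simp add: psd_mat_def)

lemma qf_add: "dim_row A = m \<Longrightarrow> dim_col A = m \<Longrightarrow> dim_row B = m \<Longrightarrow> dim_col B = m \<Longrightarrow>
    dim_row x = m \<Longrightarrow> dim_col x = 1 \<Longrightarrow> qf (A + B) x = qf A x + qf B x"
  and qf_minus: "dim_row A = m \<Longrightarrow> dim_col A = m \<Longrightarrow> dim_row B = m \<Longrightarrow> dim_col B = m \<Longrightarrow>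
    dim_row x = m \<Longrightarrow> dim_col x = 1 \<Longrightarrow> qf (A - B) x = qf A x - qf B x"
  and qf_smult: "dim_row A = m \<Longrightarrow> dim_col A = m \<Longrightarrow>
    dim_row x = m \<Longrightarrow> dim_col x = 1 \<Longrightarrow> qf (complex_of_real c \<cdot>\<^sub>m A) x = c * qf A x"
  by (simp_all add: qf_def mat_expand del: index_mult_mat(1))

lemma qf_scale: "dim_row A = m \<Longrightarrow> dim_col A = m \<Longrightarrow> dim_row x = m \<Longrightarrow> dim_col x = 1 \<Longrightarrow>
    qf A (complex_of_real c \<cdot>\<^sub>m x) = c\<^sup>2 * qf A x"
  by (simp add: qf_def mat_expand power2_eq_square del: index_mult_mat(1) flip: of_real_mult)

lemma qf_congruence: "dim_row A = m \<Longrightarrow> dim_col A = m \<Longrightarrow> dim_row C = m \<Longrightarrow> dim_col C = k \<Longrightarrow> dim_row x = k \<Longrightarrow> 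
    qf (C\<^sup>\<dagger> * A * C) x = qf A (C * x)"
  by (simp add: qf_def mat_expand del: index_mult_mat(1))

lemma qf_gram: "dim_col C = k \<Longrightarrow> dim_row x = k \<Longrightarrow> dim_row C = m \<Longrightarrow> qf (C\<^sup>\<dagger> * C) x = qf (1\<^sub>m m) (C * x)"
  by (simp add: qf_def mat_expand del: index_mult_mat(1))

lemma qf_one:
  assumes "dim_row x = m" "dim_col x = 1"
  shows "qf (1\<^sub>m m) x = (\<Sum>i<m. (cmod (x $$ (i,0)))\<^sup>2)"
proof -
  have "(x\<^sup>\<dagger> * (1\<^sub>m m * x)) $$ (0,0) = (\<Sum>i<m. cnj (x $$ (i,0)) * x $$ (i,0))"
    using assms by (simp add: one_mult_dim scalar_prod_def lessThan_atLeast0)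
  also have "\<dots> = complex_of_real (\<Sum>i<m. (cmod (x $$ (i,0)))\<^sup>2)"
    unfolding of_real_sum by (intro sum.cong) (auto simp: complex_norm_square mult.commute simp del: of_real_power)
  finally show ?thesis by (simp add: qf_def del: index_mult_mat(1))
qed

lemma qf_one_nonneg: "dim_row x = m \<Longrightarrow> dim_col x = 1 \<Longrightarrow> 0 \<le> qf (1\<^sub>m m) x"
  by (simp add: qf_one sum_nonneg)

lemma loewner_le_iff:
  "loewner_le m X Y \<longleftrightarrow> hermitian_mat m X \<and> hermitian_mat m Y \<and>
    (\<forall>x. dim_row x = m \<longrightarrow> dim_col x = 1 \<longrightarrow> qf X x \<le> qf Y x)"
proof (cases "hermitian_mat m X \<and> hermitian_mat m Y")
  case True
  then have X: "hermitian_mat m X" and Y: "hermitian_mat m Y" by auto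
  note [simp] = hermitian_mat_dim[OF X] hermitian_mat_dim[OF Y]
  have "hermitian_mat m (Y - X)" by (intro hermitian_matI) auto
  then show ?thesis using True by (auto simp: loewner_le_def psd_mat_iff qf_minus[of _ m])
qed (auto simp: loewner_le_def)

lemma loewner_leI:
  assumes "hermitian_mat m X" "hermitian_mat m Y"
    "\<And>x. dim_row x = m \<Longrightarrow> dim_col x = 1 \<Longrightarrow> qf X x \<le> qf Y x"
  shows "loewner_le m X Y"
  using assms by (auto simp: loewner_le_iff)

lemma loewner_le_trans [trans]: "loewner_le m X Y \<Longrightarrow> loewner_le m Y Z \<Longrightarrow> loewner_le m X Z"
  unfolding loewner_le_iff by force

lemma loewner_le_refl: "hermitian_mat m X \<Longrightarrow> loewner_le m X X"
  by (simp add: loewner_le_iff)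

lemma loewner_le_congruence:
  assumes "loewner_le m X Y" "dim_row C = m" "dim_col C = k"
  shows "loewner_le k (C\<^sup>\<dagger> * X * C) (C\<^sup>\<dagger> * Y * C)"
proof -
  have h: "hermitian_mat m X" "hermitian_mat m Y" using assms by (auto simp: loewner_le_iff)
  show ?thesis
    using assms h hermitian_mat_dim[OF h(1)] hermitian_mat_dim[OF h(2)]
    by (intro loewner_leI hermitian_congruence[of m]) (auto simp: qf_congruence[of _ m _ k] loewner_le_iff)
qed

lemma mat_fun_dec:
  assumes "unitary_mat m U" "A = U * real_diag m d * U\<^sup>\<dagger>"
  shows "mat_fun f A = U * real_diag m (\<lambda>i. f (d i)) * U\<^sup>\<dagger>"
  using mat_fun_eqI[OF assms, of f] by simp

lemma hermitian_dec:
  assumes "unitary_mat m U" 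
  shows "hermitian_mat m (U * real_diag m d * U\<^sup>\<dagger>)"
  using unitary_mat_dim[OF assms] by (auto intro!: hermitian_matI simp: mat_expand)

lemma hermitian_mat_fun:
  assumes "hermitian_mat m A"
  shows "hermitian_mat m (mat_fun f A)"
proof -
  obtain U d where U: "unitary_mat m U" "A = U * real_diag m d * U\<^sup>\<dagger>"
    using spectral_theorem[OF assms] by blast
  show ?thesis unfolding mat_fun_dec[OF U] by (rule hermitian_dec[OF U(1)])
qed

lemma dim_mat_fun:
  assumes "hermitian_mat m A"
  shows "dim_row (mat_fun f A) = m" "dim_col (mat_fun f A) = m" "(mat_fun f A)\<^sup>\<dagger> = mat_fun f A"
  using hermitian_mat_dim[OF hermitian_mat_fun[OF assms]] by auto

text \<open>
  Similar matrices have the same characteristic polynomial, and that of a diagonal matrix is read off.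
\<close>

lemma spectrum_dec:
  assumes U: "unitary_mat m U" and A: "A = U * real_diag m d * U\<^sup>\<dagger>"
  shows "spectrum A = (\<lambda>i. complex_of_real (d i)) ` {..<m}"
proof -
  let ?D = "real_diag m d"
  note [simp] = unitary_mat_dim[OF U]
  have Ac: "A \<in> carrier_mat m m" by (auto simp: A intro!: carrier_matI)
  have "similar_mat_wit A ?D U (U\<^sup>\<dagger>)"
    by (auto simp: similar_mat_wit_def Let_def A intro!: carrier_matI)
  then have "char_poly A = char_poly ?D" by (intro char_poly_similar) (auto simp: similar_mat_def)
  also have "\<dots> = (\<Prod>a\<leftarrow>diag_mat ?D. [:- a, 1:])"
    by (rule char_poly_upper_triangular[of _ m]) (auto simp: mat_diag_def)
  finally have "spectrum A = {k. poly (\<Prod>a\<leftarrow>diag_mat ?D. [:- a, 1:]) k = 0}"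
    using spectrum_root_char_poly[OF Ac] by simp
  also have "\<dots> = set (diag_mat ?D)" by (auto simp: poly_prod_list prod_list_zero_iff)
  also have "\<dots> = (\<lambda>i. complex_of_real (d i)) ` {..<m}"
    by (auto simp: diag_mat_def mat_diag_def)
  finally show ?thesis .
qed

lemma hermitian_on_dec:
  assumes U: "unitary_mat m U" and A: "A = U * real_diag m d * U\<^sup>\<dagger>"
  shows "hermitian_on m I A \<longleftrightarrow> (\<forall>i<m. d i \<in> I)"
  using hermitian_dec[OF U, of d] by (auto simp: hermitian_on_def spectrum_dec[OF assms] A[symmetric])

lemma hermitian_on_spectral:
  assumes "hermitian_on m I A"
  obtains U d where "unitary_mat m U" "A = U * real_diag m d * U\<^sup>\<dagger>" "\<And>i. i < m \<Longrightarrow> d i \<in> I"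
proof -
  have "hermitian_mat m A" using assms by (simp add: hermitian_on_def)
  then obtain U d where U: "unitary_mat m U" "A = U * real_diag m d * U\<^sup>\<dagger>"
    using spectral_theorem by blast
  show ?thesis using that[OF U] assms unfolding hermitian_on_dec[OF U] by blast
qed

lemma hermitian_on_hermitian: "hermitian_on m I A \<Longrightarrow> hermitian_mat m A"
  by (simp add: hermitian_on_def)

lemma hermitian_on_mono: "hermitian_on m I A \<Longrightarrow> I \<subseteq> K \<Longrightarrow> hermitian_on m K A"
  unfolding hermitian_on_def by blast

lemma qf_dec:
  assumes U: "unitary_mat m U" and x: "dim_row x = m" "dim_col x = 1"
  shows "qf (U * real_diag m d * U\<^sup>\<dagger>) x = (\<Sum>i<m. d i * (cmod ((U\<^sup>\<dagger> * x) $$ (i,0)))\<^sup>2)"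
proof -
  note [simp] = unitary_mat_dim[OF U]
  define y where "y = U\<^sup>\<dagger> * x"
  have y[simp]: "dim_row y = m" "dim_col y = 1" using x by (auto simp: y_def)
  have "qf (U * real_diag m d * U\<^sup>\<dagger>) x = qf (real_diag m d) y"
    using qf_congruence[of "real_diag m d" m "U\<^sup>\<dagger>" m x] x by (simp add: y_def)
  moreover have "(y\<^sup>\<dagger> * (real_diag m d * y)) $$ (0,0) = (\<Sum>i<m. cnj (y $$ (i,0)) * (d i * y $$ (i,0)))"
    by (subst mat_diag_mult_left[of _ m 1]) (auto simp: scalar_prod_def lessThan_atLeast0)
  then have "(y\<^sup>\<dagger> * (real_diag m d * y)) $$ (0,0) = complex_of_real (\<Sum>i<m. d i * (cmod (y $$ (i,0)))\<^sup>2)"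
    unfolding of_real_sum of_real_mult complex_norm_square by (auto simp: mult_ac intro!: sum.cong)
  then have "qf (real_diag m d) y = (\<Sum>i<m. d i * (cmod (y $$ (i,0)))\<^sup>2)"
    by (simp add: qf_def del: index_mult_mat(1))
  ultimately show ?thesis by (simp add: y_def)
qed

lemma mat_fun_le:
  assumes "hermitian_on m I A" "\<And>t. t \<in> I \<Longrightarrow> f t \<le> g t"
  shows "loewner_le m (mat_fun f A) (mat_fun g A)"
proof -
  obtain U d where U: "unitary_mat m U" "A = U * real_diag m d * U\<^sup>\<dagger>" "\<And>i. i < m \<Longrightarrow> d i \<in> I"
    using hermitian_on_spectral[OF assms(1)] by blast
  have "hermitian_mat m A" using assms by (simp add: hermitian_on_def)
  then show ?thesis
  proof (intro loewner_leI hermitian_mat_fun)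
    fix x :: "complex mat" assume x: "dim_row x = m" "dim_col x = 1"
    show "qf (mat_fun f A) x \<le> qf (mat_fun g A) x"
      unfolding mat_fun_dec[OF U(1,2)] qf_dec[OF U(1) x]
      using U(3) assms(2) by (intro sum_mono mult_right_mono) auto
  qed
qed

lemma mat_fun_cong:
  assumes "hermitian_on m I A" "\<And>t. t \<in> I \<Longrightarrow> f t = g t"
  shows "mat_fun f A = mat_fun g A"
proof -
  obtain U d where U: "unitary_mat m U" "A = U * real_diag m d * U\<^sup>\<dagger>" "\<And>i. i < m \<Longrightarrow> d i \<in> I"
    using hermitian_on_spectral[OF assms(1)] by blast
  have "real_diag m (\<lambda>i. f (d i)) = real_diag m (\<lambda>i. g (d i))"
    using U assms by (auto simp: mat_diag_def intro!: eq_matI)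
  then show ?thesis by (simp add: mat_fun_dec[OF U(1,2)])
qed

lemma mat_fun_mult:
  assumes "hermitian_mat m A"
  shows "mat_fun f A * mat_fun g A = mat_fun (\<lambda>t. f t * g t) A"
proof -
  obtain U d where U: "unitary_mat m U" "A = U * real_diag m d * U\<^sup>\<dagger>"
    using spectral_theorem[OF assms(1)] by blast
  note [simp] = unitary_mat_dim[OF U(1)]
  show ?thesis unfolding mat_fun_dec[OF U]
    by (simp add: mat_expand mult_cancel_dim[of "U\<^sup>\<dagger>" U m])
       (simp flip: mult_assoc_dim)
qed

lemma mat_fun_add:
  assumes "hermitian_mat m A"
  shows "mat_fun (\<lambda>t. f t + g t) A = mat_fun f A + mat_fun g A"
proof -
  obtain U d where U: "unitary_mat m U" "A = U * real_diag m d * U\<^sup>\<dagger>"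
    using spectral_theorem[OF assms(1)] by blast
  note [simp] = unitary_mat_dim[OF U(1)]
  have "real_diag m (\<lambda>i. f (d i) + g (d i)) = real_diag m (\<lambda>i. f (d i)) + real_diag m (\<lambda>i. g (d i))"
    by (rule eq_matI) (auto simp: mat_diag_def)
  then show ?thesis unfolding mat_fun_dec[OF U] by (simp add: mat_expand)
qed

lemma mat_fun_smult:
  assumes "hermitian_mat m A"
  shows "mat_fun (\<lambda>t. c * f t) A = complex_of_real c \<cdot>\<^sub>m mat_fun f A"
proof -
  obtain U d where U: "unitary_mat m U" "A = U * real_diag m d * U\<^sup>\<dagger>"
    using spectral_theorem[OF assms(1)] by blast
  note [simp] = unitary_mat_dim[OF U(1)]
  have "real_diag m (\<lambda>i. c * f (d i)) = complex_of_real c \<cdot>\<^sub>m real_diag m (\<lambda>i. f (d i))"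
    by (rule eq_matI) (auto simp: mat_diag_def)
  then show ?thesis unfolding mat_fun_dec[OF U] by (simp add: mat_expand)
qed

lemma mat_fun_id:
  assumes "hermitian_mat m A"
  shows "mat_fun (\<lambda>t. t) A = A"
proof -
  obtain U d where U: "unitary_mat m U" "A = U * real_diag m d * U\<^sup>\<dagger>"
    using spectral_theorem[OF assms] by blast
  show ?thesis using mat_fun_dec[OF U, of "\<lambda>t. t"] U(2) by simp
qed

lemma mat_fun_const:
  assumes "hermitian_mat m A"
  shows "mat_fun (\<lambda>t. c) A = complex_of_real c \<cdot>\<^sub>m 1\<^sub>m m"
proof -
  obtain U d where U: "unitary_mat m U" "A = U * real_diag m d * U\<^sup>\<dagger>"
    using spectral_theorem[OF assms(1)] by blast
  note [simp] = unitary_mat_dim[OF U(1)]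
  have "real_diag m (\<lambda>i. c) = complex_of_real c \<cdot>\<^sub>m 1\<^sub>m m"
    by (rule eq_matI) (auto simp: mat_diag_def)
  then show ?thesis unfolding mat_fun_dec[OF U] by (simp add: mat_expand)
qed

lemma unitary_one: "unitary_mat m (1\<^sub>m m)"
  by (auto simp: unitary_mat_def)

lemma scalar_mat_dec: "complex_of_real c \<cdot>\<^sub>m 1\<^sub>m m = 1\<^sub>m m * real_diag m (\<lambda>_. c) * (1\<^sub>m m)\<^sup>\<dagger>"
  by (rule eq_matI) (auto simp: mat_expand mat_diag_def simp del: index_mult_mat(1))

lemma mat_fun_scalar: "mat_fun f (complex_of_real c \<cdot>\<^sub>m 1\<^sub>m m) = complex_of_real (f c) \<cdot>\<^sub>m 1\<^sub>m m"
  using mat_fun_dec[OF unitary_one scalar_mat_dec, of f c m]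
  unfolding scalar_mat_dec[symmetric] .

lemma hermitian_scalar: "hermitian_mat m (complex_of_real c \<cdot>\<^sub>m 1\<^sub>m m)"
  by (auto intro!: hermitian_matI)

lemma hermitian_on_scalar: "c \<in> I \<Longrightarrow> hermitian_on m I (complex_of_real c \<cdot>\<^sub>m 1\<^sub>m m)"
  using hermitian_on_dec[OF unitary_one scalar_mat_dec, of m I c] by blast

text \<open>
  In eigenbases of \<open>A\<close> and \<open>B\<close> the hypothesis says \<open>d\<^sub>i X\<^sub>i\<^sub>j = X\<^sub>i\<^sub>j e\<^sub>j\<close>: an entry of \<open>X\<close> can be nonzero
  only where the eigenvalues agree, and there \<open>f\<close> takes the same value.
\<close>

lemma mat_fun_intertwine:
  assumes A: "hermitian_mat m A" and B: "hermitian_mat k B"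
    and W: "dim_row W = m" "dim_col W = k" "A * W = W * B"
  shows "mat_fun f A * W = W * mat_fun f B"
proof -
  obtain U d where U: "unitary_mat m U" "A = U * real_diag m d * U\<^sup>\<dagger>"
    using spectral_theorem[OF A] by blast
  obtain V e where V: "unitary_mat k V" "B = V * real_diag k e * V\<^sup>\<dagger>"
    using spectral_theorem[OF B] by blast
  note [simp] = unitary_mat_dim[OF U(1)] unitary_mat_dim[OF V(1)] W(1,2)
  note canc = mult_cancel_dim[of U "U\<^sup>\<dagger>" m] mult_cancel_dim[of "U\<^sup>\<dagger>" U m]
    mult_cancel_dim[of V "V\<^sup>\<dagger>" k] mult_cancel_dim[of "V\<^sup>\<dagger>" V k]
  define X where "X = U\<^sup>\<dagger> * W * V"
  have Xc: "X \<in> carrier_mat m k" by (auto simp: X_def intro!: carrier_matI)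
  then have [simp]: "dim_row X = m" "dim_col X = k" by auto
  have WX: "W = U * X * V\<^sup>\<dagger>" by (simp add: X_def mat_expand canc mult_one_dim)
  have "real_diag m d * X = U\<^sup>\<dagger> * (A * W) * V" by (simp add: X_def U(2) mat_expand canc)
  also have "\<dots> = X * real_diag k e" unfolding W(3) by (simp add: X_def V(2) mat_expand canc mult_one_dim)
  finally have eq: "complex_of_real (d i) * X $$ (i,j) = X $$ (i,j) * complex_of_real (e j)" if "i < m" "j < k" for i j
    using that unfolding mat_diag_mult_left[OF Xc] mat_diag_mult_right[OF Xc]
    by (auto dest!: arg_cong[where f = "\<lambda>M. M $$ (i,j)"])
  have "complex_of_real (f (d i)) * X $$ (i,j) = X $$ (i,j) * complex_of_real (f (e j))" if "i < m" "j < k" for i j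
    using eq[OF that] by (cases "X $$ (i,j) = 0") (auto simp: mult.commute)
  then have "real_diag m (\<lambda>i. f (d i)) * X = X * real_diag k (\<lambda>i. f (e i))"
    unfolding mat_diag_mult_left[OF Xc] mat_diag_mult_right[OF Xc] by (intro eq_matI) auto
  then have "U * (real_diag m (\<lambda>i. f (d i)) * X) * V\<^sup>\<dagger> = U * (X * real_diag k (\<lambda>i. f (e i))) * V\<^sup>\<dagger>" by simp
  then show ?thesis
    unfolding mat_fun_dec[OF U] mat_fun_dec[OF V] WX by (simp add: mat_expand canc)
qed

text \<open>
  Spectra in an interval are controlled by quadratic forms from now on; this is how they are tracked
  through compressions, sums and perturbations.
\<close>

lemma hermitian_on_interval_iff:
  "hermitian_on m {a..b} A \<longleftrightarrow> hermitian_mat m A \<and>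
    (\<forall>x. dim_row x = m \<longrightarrow> dim_col x = 1 \<longrightarrow> a * qf (1\<^sub>m m) x \<le> qf A x \<and> qf A x \<le> b * qf (1\<^sub>m m) x)"
    (is "?L \<longleftrightarrow> ?R")
proof
  assume L: ?L
  then have h: "hermitian_mat m A" by (simp add: hermitian_on_def)
  have "loewner_le m (mat_fun (\<lambda>_. a) A) (mat_fun (\<lambda>t. t) A)" "loewner_le m (mat_fun (\<lambda>t. t) A) (mat_fun (\<lambda>_. b) A)"
    using L by (auto intro!: mat_fun_le)
  then show ?R using h by (auto simp: mat_fun_id mat_fun_const loewner_le_iff qf_smult)
next
  assume R: ?R
  then obtain U d where U: "unitary_mat m U" "A = U * real_diag m d * U\<^sup>\<dagger>"
    using spectral_theorem by blast
  note [simp] = unitary_mat_dim[OF U(1)]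
  have "a \<le> d i \<and> d i \<le> b" if i: "i < m" for i
  proof -
    define x where "x = U * embed m 1 i"
    have x: "dim_row x = m" "dim_col x = 1" by (auto simp: x_def)
    have Ux: "U\<^sup>\<dagger> * x = embed m 1 i" by (simp add: x_def mult_cancel_dim[of "U\<^sup>\<dagger>" U m])
    have *: "qf (U * real_diag m e * U\<^sup>\<dagger>) x = e i" for e
    proof -
      have "qf (U * real_diag m e * U\<^sup>\<dagger>) x = (\<Sum>j<m. if j = i then e i else 0)"
        unfolding qf_dec[OF U(1) x] Ux by (rule sum.cong) (auto simp: index_embed)
      then show ?thesis using i by simp
    qed
    have "qf (1\<^sub>m m) x = 1" using *[of "\<lambda>_. 1"] by (simp add: mat_expand)
    then show ?thesis using R x *[of d] U(2) by force
  qed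
  then show ?L using hermitian_on_dec[OF U] by auto
qed

lemma vec_l2norm_column: "vec_l2norm v = sqrt (qf (1\<^sub>m (dim_vec v)) (column v))"
  by (simp add: vec_l2norm_def L2_set_def qf_one column_def)

text \<open>
  The operator norm is a supremum, and is usable only once the set is bounded; the bound comes from
  the eigenvalues of \<open>C\<^sup>\<dagger> C\<close>. The rest is homogeneity of the quadratic form.
\<close>

lemma contraction_mat_iff:
  "contraction_mat m C \<longleftrightarrow> dim_row C = m \<and> dim_col C = m \<and>
    (\<forall>x. dim_row x = m \<longrightarrow> dim_col x = 1 \<longrightarrow> qf (C\<^sup>\<dagger> * C) x \<le> qf (1\<^sub>m m) x)"
proof (cases "dim_row C = m \<and> dim_col C = m")
  case dim: True
  then have [simp]: "dim_row C = m" "dim_col C = m" by auto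
  define S where "S = {v \<in> carrier_vec m. vec_l2norm v \<le> 1}"
  have norm: "vec_l2norm (C *\<^sub>v v) = sqrt (qf (C\<^sup>\<dagger> * C) (column v))" if "v \<in> carrier_vec m" for v
    using that by (simp add: vec_l2norm_column column_mult qf_gram[of C m _ m])
  have "hermitian_mat m (C\<^sup>\<dagger> * C)" by (intro hermitian_matI) auto
  then obtain U d where U: "unitary_mat m U" "C\<^sup>\<dagger> * C = U * real_diag m d * U\<^sup>\<dagger>"
    using spectral_theorem by blast
  \<comment> \<open>a crude bound for the eigenvalues, which is enough for the supremum to exist\<close>
  define r where "r = (\<Sum>i<m. \<bar>d i\<bar>)"
  have "\<bar>d i\<bar> \<le> r" if "i < m" for i unfolding r_def using that by (intro member_le_sum) auto
  then have "hermitian_on m {-r..r} (C\<^sup>\<dagger> * C)" unfolding hermitian_on_dec[OF U] by force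
  then have r: "qf (C\<^sup>\<dagger> * C) x \<le> r * qf (1\<^sub>m m) x" if "dim_row x = m" "dim_col x = 1" for x
    using that unfolding hermitian_on_interval_iff by blast
  have "r \<ge> 0" by (auto simp: r_def intro: sum_nonneg)
  have one: "qf (1\<^sub>m m) (column v) \<le> 1" if "v \<in> S" for v
    using that by (auto simp: S_def vec_l2norm_column)
  have bdd: "bdd_above ((\<lambda>v. vec_l2norm (C *\<^sub>v v)) ` S)"
  proof (rule bdd_aboveI2[of _ _ "sqrt r"])
    fix v assume v: "v \<in> S"
    then have vm: "v \<in> carrier_vec m" by (simp add: S_def)
    have "qf (C\<^sup>\<dagger> * C) (column v) \<le> r * qf (1\<^sub>m m) (column v)" using r vm by auto
    also have "\<dots> \<le> r * 1" using one[OF v] \<open>r \<ge> 0\<close> by (intro mult_left_mono) auto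
    finally show "vec_l2norm (C *\<^sub>v v) \<le> sqrt r" using norm[OF vm] by simp
  qed
  have "0\<^sub>v m \<in> S" by (simp add: S_def vec_l2norm_def L2_set_def)
  then have "S \<noteq> {}" by blast
  have "contraction_mat m C \<longleftrightarrow> (SUP v\<in>S. vec_l2norm (C *\<^sub>v v)) \<le> 1"
    using dim by (auto simp: contraction_mat_def mat_opnorm_def S_def intro: carrier_matI)
  also have "\<dots> \<longleftrightarrow> (\<forall>v\<in>S. vec_l2norm (C *\<^sub>v v) \<le> 1)" by (rule cSUP_le_iff[OF \<open>S \<noteq> {}\<close> bdd])
  also have "\<dots> \<longleftrightarrow> (\<forall>v\<in>S. qf (C\<^sup>\<dagger> * C) (column v) \<le> 1)" 
    by (intro ball_cong) (auto simp: norm S_def)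
  also have "\<dots> \<longleftrightarrow> (\<forall>x. dim_row x = m \<longrightarrow> dim_col x = 1 \<longrightarrow> qf (C\<^sup>\<dagger> * C) x \<le> qf (1\<^sub>m m) x)"
  proof (intro iffI allI impI ballI)
    fix v assume "\<forall>x. dim_row x = m \<longrightarrow> dim_col x = 1 \<longrightarrow> qf (C\<^sup>\<dagger> * C) x \<le> qf (1\<^sub>m m) x" and v: "v \<in> S"
    then have "qf (C\<^sup>\<dagger> * C) (column v) \<le> qf (1\<^sub>m m) (column v)" by (auto simp: S_def)
    also have "\<dots> \<le> 1" by (rule one[OF v])
    finally show "qf (C\<^sup>\<dagger> * C) (column v) \<le> 1" .
  next
    fix x :: "complex mat"
    assume S: "\<forall>v\<in>S. qf (C\<^sup>\<dagger> * C) (column v) \<le> 1" and x: "dim_row x = m" "dim_col x = 1"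
    define N where "N = qf (1\<^sub>m m) x"
    have "N \<ge> 0" using qf_one_nonneg[OF x] by (simp add: N_def)
    show "qf (C\<^sup>\<dagger> * C) x \<le> qf (1\<^sub>m m) x"
    proof (cases "N = 0")
      case True
      then show ?thesis using r[OF x] by (simp add: N_def)
    next
      case False
      define v where "v = complex_of_real (1 / sqrt N) \<cdot>\<^sub>v col x 0"
      have cv: "column v = complex_of_real (1 / sqrt N) \<cdot>\<^sub>m x" using x by (simp add: v_def column_smult column_col)
      have sc: "(1 / sqrt N)\<^sup>2 = 1 / N" using \<open>N \<ge> 0\<close> by (simp add: power_divide)
      have v: "v \<in> carrier_vec m" using x by (auto simp: v_def carrier_vecI)
      have "qf (1\<^sub>m m) (column v) = 1"
        unfolding cv using False x by (subst qf_scale[of _ m]) (auto simp: sc simp flip: N_def)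
      then have "v \<in> S" using v by (auto simp: S_def vec_l2norm_column)
      then have "qf (C\<^sup>\<dagger> * C) (column v) \<le> 1" using S by blast
      moreover have "qf (C\<^sup>\<dagger> * C) (column v) = 1 / N * qf (C\<^sup>\<dagger> * C) x"
        unfolding cv using x by (subst qf_scale[of _ m]) (auto simp: sc)
      ultimately show ?thesis using False \<open>N \<ge> 0\<close> by (simp add: field_simps flip: N_def)
    qed
  qed
  finally show ?thesis using dim by simp
qed (auto simp: contraction_mat_def)

section \<open>Gram matrices, inversion and continuity\<close>

text \<open>
  With \<open>G = Z Z\<^sup>\<dagger>\<close> one has \<open>0 \<le> \<parallel>(1 - G) x\<parallel>\<^sup>2 = \<parallel>x\<parallel>\<^sup>2 - 2 \<langle>G x, x\<rangle> + \<parallel>G x\<parallel>\<^sup>2\<close>, and the hypothesis gives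
  \<open>\<parallel>G x\<parallel>\<^sup>2 \<le> \<parallel>Z\<^sup>\<dagger> x\<parallel>\<^sup>2 = \<langle>G x, x\<rangle>\<close>.
\<close>

lemma loewner_gram_swap:
  assumes Z: "dim_row Z = n" "dim_col Z = k" and le: "loewner_le k (Z\<^sup>\<dagger> * Z) (1\<^sub>m k)"
  shows "loewner_le n (Z * Z\<^sup>\<dagger>) (1\<^sub>m n)"
proof (intro loewner_leI)
  fix x :: "complex mat" assume x: "dim_row x = n" "dim_col x = 1"
  define G where "G = Z * Z\<^sup>\<dagger>"
  have G [simp]: "dim_row G = n" "dim_col G = n" "G\<^sup>\<dagger> = G" using Z by (auto simp: G_def)
  have "0 \<le> qf (1\<^sub>m n) ((1\<^sub>m n - G) * x)" using x by (intro qf_one_nonneg) auto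
  also have "\<dots> = qf ((1\<^sub>m n - G)\<^sup>\<dagger> * (1\<^sub>m n - G)) x" using x by (intro qf_gram[symmetric]) auto
  also have "(1\<^sub>m n - G)\<^sup>\<dagger> * (1\<^sub>m n - G) = (1\<^sub>m n - G) - (G - G * G)" by (simp add: mat_expand)
  also have "qf \<dots> x = qf (1\<^sub>m n) x - 2 * qf G x + qf (G * G) x"
    using x by (simp add: qf_minus[of _ n])
  also have "G * G = (Z\<^sup>\<dagger>)\<^sup>\<dagger> * (Z\<^sup>\<dagger> * Z) * Z\<^sup>\<dagger>" using Z by (simp add: G_def mat_expand)
  also have "qf \<dots> x = qf (Z\<^sup>\<dagger> * Z) (Z\<^sup>\<dagger> * x)" using Z x by (intro qf_congruence[of _ k _ n]) auto
  also have "qf (Z\<^sup>\<dagger> * Z) (Z\<^sup>\<dagger> * x) \<le> qf (1\<^sub>m k) (Z\<^sup>\<dagger> * x)" using le Z x by (auto simp: loewner_le_iff)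
  also have "qf (1\<^sub>m k) (Z\<^sup>\<dagger> * x) = qf G x" using qf_gram[of "Z\<^sup>\<dagger>" n x k] Z x by (simp add: G_def)
  finally show "qf (Z * Z\<^sup>\<dagger>) x \<le> qf (1\<^sub>m n) x" by (simp add: G_def)
qed (use Z in \<open>auto intro!: hermitian_matI\<close>)

text \<open>
  Inversion is antitone: \<open>Y \<le> X\<close> means \<open>Z\<^sup>\<dagger> Z \<le> 1\<close> for \<open>Z = Y\<^bsup>1/2\<^esup> X\<^bsup>-1/2\<^esup>\<close>, and \<open>Z Z\<^sup>\<dagger> \<le> 1\<close> means
  \<open>X\<^sup>-\<^sup>1 \<le> Y\<^sup>-\<^sup>1\<close>. Stating it for \<open>X = h(A)\<close> and \<open>Y = h(B)\<close> provides the roots and inverses.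
\<close>

lemma loewner_inverse_antimono:
  assumes A: "hermitian_on m I A" and B: "hermitian_on m I B" and h: "\<And>t. t \<in> I \<Longrightarrow> h t > 0"
    and le: "loewner_le m (mat_fun h B) (mat_fun h A)"
  shows "loewner_le m (mat_fun (\<lambda>t. 1 / h t) A) (mat_fun (\<lambda>t. 1 / h t) B)"
proof -
  note hA = hermitian_on_hermitian[OF A] and hB = hermitian_on_hermitian[OF B]
  define P where "P = mat_fun (\<lambda>t. sqrt (h t)) B"
  define P' where "P' = mat_fun (\<lambda>t. 1 / sqrt (h t)) B"
  define Q where "Q = mat_fun (\<lambda>t. 1 / sqrt (h t)) A"
  have [simp]: "dim_row P = m" "dim_col P = m" "P\<^sup>\<dagger> = P" "dim_row P' = m" "dim_col P' = m" "P'\<^sup>\<dagger> = P'"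
    "dim_row Q = m" "dim_col Q = m" "Q\<^sup>\<dagger> = Q"
    using dim_mat_fun[OF hA] dim_mat_fun[OF hB] by (simp_all add: P_def P'_def Q_def)
  have PP: "mat_fun h B = P * P" unfolding P_def mat_fun_mult[OF hB]
    using h by (intro mat_fun_cong[OF B]) (auto simp: less_imp_le)
  have "P' * P = mat_fun (\<lambda>_. 1) B" "P * P' = mat_fun (\<lambda>_. 1) B"
    unfolding P_def P'_def mat_fun_mult[OF hB] by (intro mat_fun_cong[OF B]; use h in force)+
  moreover have "mat_fun (\<lambda>_. 1) B = 1\<^sub>m m" by (auto simp: mat_fun_const[OF hB] intro!: eq_matI)
  ultimately have P'P: "P' * P = 1\<^sub>m m" "P * P' = 1\<^sub>m m" by auto
  have P'P': "mat_fun (\<lambda>t. 1 / h t) B = P' * P'" unfolding P'_def mat_fun_mult[OF hB]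
    using h by (intro mat_fun_cong[OF B]) (auto simp: less_imp_le)
  have QQ: "mat_fun (\<lambda>t. 1 / h t) A = Q * Q" unfolding Q_def mat_fun_mult[OF hA]
    using h by (intro mat_fun_cong[OF A]) (auto simp: less_imp_le)
  have "Q * mat_fun h A * Q = mat_fun (\<lambda>_. 1) A" unfolding Q_def mat_fun_mult[OF hA]
    by (intro mat_fun_cong[OF A]; use h in force)
  then have QhQ: "Q\<^sup>\<dagger> * mat_fun h A * Q = 1\<^sub>m m" by (auto simp: mat_fun_const[OF hA] intro!: eq_matI)
  have "loewner_le m (Q\<^sup>\<dagger> * mat_fun h B * Q) (Q\<^sup>\<dagger> * mat_fun h A * Q)"
    by (rule loewner_le_congruence[OF le]) auto
  then have "loewner_le m ((P * Q)\<^sup>\<dagger> * (P * Q)) (1\<^sub>m m)" unfolding QhQ by (simp add: PP mat_expand)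
  then have "loewner_le m ((P * Q) * (P * Q)\<^sup>\<dagger>) (1\<^sub>m m)" by (intro loewner_gram_swap) auto
  then have "loewner_le m (P'\<^sup>\<dagger> * ((P * Q) * (P * Q)\<^sup>\<dagger>) * P') (P'\<^sup>\<dagger> * 1\<^sub>m m * P')"
    by (rule loewner_le_congruence) auto
  then show ?thesis unfolding QQ P'P'
    by (simp add: mat_expand mult_cancel_dim[OF P'P(1)] P'P(2))
qed

text \<open>
  A modulus of continuity that is a polynomial in \<open>s\<close>, so that it can be evaluated at a matrix: near
  \<open>t\<close> the term \<open>\<eta>\<close> suffices, elsewhere \<open>(s - t)\<^sup>2\<close> is bounded below.
\<close>

lemma square_modulus_of_continuity:
  fixes f :: "real \<Rightarrow> real"
  assumes f: "continuous_on {a..b} f" and t: "t \<in> {a..b}" and \<eta>: "\<eta> > 0"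
  obtains K where "K \<ge> 0" "\<And>s. s \<in> {a..b} \<Longrightarrow> (f s - f t)\<^sup>2 \<le> \<eta> + K * (s - t)\<^sup>2"
proof -
  have c: "continuous_on {a..b} (\<lambda>s. (f s - f t)\<^sup>2)" by (intro continuous_intros f)
  obtain M where M: "\<And>s. s \<in> {a..b} \<Longrightarrow> (f s - f t)\<^sup>2 \<le> M"
    using continuous_attains_sup[OF compact_Icc _ c] t by blast
  have "M \<ge> 0" using M[OF t] by simp
  have "((\<lambda>s. (f s - f t)\<^sup>2) \<longlongrightarrow> (f t - f t)\<^sup>2) (at t within {a..b})"
    using c t unfolding continuous_on_def by blast
  then have "eventually (\<lambda>s. (f s - f t)\<^sup>2 < \<eta>) (at t within {a..b})"
    by (rule order_tendstoD) (use \<eta> in simp)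
  then obtain \<delta> where \<delta>: "\<delta> > 0" "\<And>s. s \<in> {a..b} \<Longrightarrow> s \<noteq> t \<Longrightarrow> dist s t < \<delta> \<Longrightarrow> (f s - f t)\<^sup>2 < \<eta>"
    unfolding eventually_at by auto
  show thesis
  proof (rule that[of "M / \<delta>\<^sup>2"])
    fix s assume s: "s \<in> {a..b}"
    show "(f s - f t)\<^sup>2 \<le> \<eta> + M / \<delta>\<^sup>2 * (s - t)\<^sup>2"
    proof (cases "dist s t < \<delta>")
      case True
      then have "(f s - f t)\<^sup>2 < \<eta>" using \<delta>(2)[OF s] \<eta> by (cases "s = t") auto
      moreover have "0 \<le> M / \<delta>\<^sup>2 * (s - t)\<^sup>2" using \<open>M \<ge> 0\<close> by simp
      ultimately show ?thesis by linarith
    next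
      case False
      then have "\<delta>\<^sup>2 \<le> \<bar>s - t\<bar>\<^sup>2" using \<delta>(1) by (intro power_mono) (auto simp: dist_real_def)
      then have "1 \<le> (s - t)\<^sup>2 / \<delta>\<^sup>2" using \<delta>(1) by (simp add: field_simps)
      then have "M * 1 \<le> M * ((s - t)\<^sup>2 / \<delta>\<^sup>2)" using \<open>M \<ge> 0\<close> by (intro mult_left_mono) auto
      then show ?thesis using M[OF s] \<eta> by simp
    qed
  qed (use \<open>M \<ge> 0\<close> in simp)
qed

lemma qf_square_deviation:
  assumes B: "hermitian_mat m B" and x: "dim_row x = m" "dim_col x = 1"
  shows "qf (mat_fun (\<lambda>s. (g s - c)\<^sup>2) B) x = qf (1\<^sub>m m) (mat_fun g B * x - complex_of_real c \<cdot>\<^sub>m x)"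
proof -
  note [simp] = dim_mat_fun[OF B]
  have M: "mat_fun (\<lambda>s. g s - c) B = mat_fun g B - complex_of_real c \<cdot>\<^sub>m 1\<^sub>m m"
    using mat_fun_add[OF B, of g "\<lambda>_. - c"] by (auto simp: mat_fun_const[OF B] intro!: eq_matI)
  have "mat_fun (\<lambda>s. (g s - c)\<^sup>2) B = (mat_fun (\<lambda>s. g s - c) B)\<^sup>\<dagger> * mat_fun (\<lambda>s. g s - c) B"
    by (simp add: mat_fun_mult[OF B] power2_eq_square)
  then have "qf (mat_fun (\<lambda>s. (g s - c)\<^sup>2) B) x = qf (1\<^sub>m m) (mat_fun (\<lambda>s. g s - c) B * x)"
    using x by (simp only: ) (intro qf_gram; simp)
  then show ?thesis using x by (simp add: M mat_expand)
qed

lemma mat_fun_eigen: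
  assumes A: "hermitian_mat m A" and x: "dim_row x = m" "dim_col x = 1" "A * x = complex_of_real t \<cdot>\<^sub>m x"
  shows "mat_fun f A * x = complex_of_real (f t) \<cdot>\<^sub>m x"
proof -
  have "mat_fun f A * x = x * mat_fun f (complex_of_real t \<cdot>\<^sub>m 1\<^sub>m 1)"
    using x by (intro mat_fun_intertwine[OF A hermitian_scalar]) (auto simp: mat_expand)
  then show ?thesis using x by (simp add: mat_fun_scalar mat_expand)
qed

text \<open>
  If \<open>x\<close> is a unit eigenvector of \<open>A\<close> for \<open>t\<close> and \<open>B = A + \<epsilon> E\<close>, then
  \<open>\<parallel>(f(B) - f(A)) x\<parallel>\<^sup>2 = \<langle>(f(B) - f(t))\<^sup>2 x, x\<rangle> \<le> \<eta> + K \<parallel>(B - t) x\<parallel>\<^sup>2\<close>, and \<open>(B - t) x = \<epsilon> E x\<close>.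
\<close>

lemma mat_fun_tendsto_eigenvector:
  assumes A: "hermitian_on m {a..b} A" and E: "hermitian_mat m E"
    and B: "\<And>\<epsilon>. 0 < \<epsilon> \<Longrightarrow> \<epsilon> \<le> \<epsilon>0 \<Longrightarrow> hermitian_on m {a..b} (A + complex_of_real \<epsilon> \<cdot>\<^sub>m E)" and "\<epsilon>0 > 0"
    and f: "continuous_on {a..b} f"
    and x: "dim_row x = m" "dim_col x = 1" "A * x = complex_of_real t \<cdot>\<^sub>m x" and t: "t \<in> {a..b}"
    and one: "qf (1\<^sub>m m) x = 1"
  shows "((\<lambda>\<epsilon>. qf (1\<^sub>m m) ((mat_fun f (A + complex_of_real \<epsilon> \<cdot>\<^sub>m E) - mat_fun f A) * x)) \<longlongrightarrow> 0) (at_right 0)"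
proof (rule tendstoI)
  fix \<eta> :: real assume "\<eta> > 0"
  note hA = hermitian_on_hermitian[OF A]
  note [simp] = hermitian_mat_dim[OF E] hermitian_mat_dim[OF hA] dim_mat_fun[OF hA]
  obtain K where K: "K \<ge> 0" "\<And>s. s \<in> {a..b} \<Longrightarrow> (f s - f t)\<^sup>2 \<le> \<eta> / 2 + K * (s - t)\<^sup>2"
    using square_modulus_of_continuity[OF f t, of "\<eta> / 2"] \<open>\<eta> > 0\<close> by auto
  define q where "q = qf (1\<^sub>m m) (E * x)"
  have bound: "qf (1\<^sub>m m) ((mat_fun f (A + complex_of_real \<epsilon> \<cdot>\<^sub>m E) - mat_fun f A) * x) \<le> \<eta> / 2 + K * q * \<epsilon>\<^sup>2"
    if \<epsilon>: "0 < \<epsilon>" "\<epsilon> \<le> \<epsilon>0" for \<epsilon>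
  proof -
    let ?B = "A + complex_of_real \<epsilon> \<cdot>\<^sub>m E"
    note hB = hermitian_on_hermitian[OF B[OF \<epsilon>]]
    note [simp] = dim_mat_fun[OF hB]
    have "(mat_fun f ?B - mat_fun f A) * x = mat_fun f ?B * x - complex_of_real (f t) \<cdot>\<^sub>m x"
      using x by (simp add: mat_expand mat_fun_eigen[OF hA x])
    then have "qf (1\<^sub>m m) ((mat_fun f ?B - mat_fun f A) * x) = qf (mat_fun (\<lambda>s. (f s - f t)\<^sup>2) ?B) x"
      by (simp add: qf_square_deviation[OF hB x(1,2)])
    also have "\<dots> \<le> qf (mat_fun (\<lambda>s. \<eta> / 2 + K * (s - t)\<^sup>2) ?B) x"
    proof -
      have "loewner_le m (mat_fun (\<lambda>s. (f s - f t)\<^sup>2) ?B) (mat_fun (\<lambda>s. \<eta> / 2 + K * (s - t)\<^sup>2) ?B)"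
        by (rule mat_fun_le[OF B[OF \<epsilon>] K(2)])
      then show ?thesis using x(1,2) unfolding loewner_le_iff by simp
    qed
    also have "\<dots> = \<eta> / 2 + K * qf (mat_fun (\<lambda>s. (s - t)\<^sup>2) ?B) x"
      using x one by (simp add: mat_fun_add[OF hB] mat_fun_smult[OF hB] mat_fun_const[OF hB] qf_add[of _ m] qf_smult[of _ m] del: of_real_divide)
    also have "qf (mat_fun (\<lambda>s. (s - t)\<^sup>2) ?B) x = qf (1\<^sub>m m) (complex_of_real \<epsilon> \<cdot>\<^sub>m (E * x))"
    proof -
      have "?B * x - complex_of_real t \<cdot>\<^sub>m x = complex_of_real \<epsilon> \<cdot>\<^sub>m (E * x)"
        using x by (auto simp: mat_expand simp del: index_mult_mat(1) intro!: eq_matI)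
      then show ?thesis by (simp add: qf_square_deviation[OF hB x(1,2)] mat_fun_id[OF hB])
    qed
    also have "\<dots> = \<epsilon>\<^sup>2 * q" using x unfolding q_def by (intro qf_scale) auto
    finally show ?thesis by (simp add: mult_ac)
  qed
  have "((\<lambda>\<epsilon>. \<eta> / 2 + K * q * \<epsilon>\<^sup>2) \<longlongrightarrow> \<eta> / 2 + K * q * 0\<^sup>2) (at_right 0)" by (intro tendsto_intros)
  then have "eventually (\<lambda>\<epsilon>. \<eta> / 2 + K * q * \<epsilon>\<^sup>2 < \<eta>) (at_right 0)"
    by (rule order_tendstoD) (use \<open>\<eta> > 0\<close> in simp)
  moreover have "eventually (\<lambda>\<epsilon>. \<epsilon> \<in> {0<..<\<epsilon>0}) (at_right 0)"
    using eventually_at_right_real[OF \<open>\<epsilon>0 > 0\<close>] .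
  ultimately show "\<forall>\<^sub>F \<epsilon> in at_right 0.
      dist (qf (1\<^sub>m m) ((mat_fun f (A + complex_of_real \<epsilon> \<cdot>\<^sub>m E) - mat_fun f A) * x)) 0 < \<eta>"
  proof eventually_elim
    case (elim \<epsilon>)
    note hB = hermitian_on_hermitian[OF B[of \<epsilon>]]
    have "0 \<le> qf (1\<^sub>m m) ((mat_fun f (A + complex_of_real \<epsilon> \<cdot>\<^sub>m E) - mat_fun f A) * x)"
      using x by (intro qf_one_nonneg) auto
    then show ?case using bound[of \<epsilon>] elim by (simp add: dist_real_def)
  qed
qed

lemma index_mult_embed:
  assumes "dim_col M = m" "j < dim_row M" "i < m"
  shows "(M * embed m 1 i) $$ (j,0) = M $$ (j,i)"
proof -
  have "(M * embed m 1 i) $$ (j,0) = (\<Sum>l<m. M $$ (j,l) * (if l = i then 1 else 0))"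
    using assms by (simp add: embed_def scalar_prod_def lessThan_atLeast0)
  also have "\<dots> = (\<Sum>l<m. if l = i then M $$ (j,i) else 0)" by (rule sum.cong) auto
  finally show ?thesis using assms by simp
qed

text \<open>
  The eigenvectors of \<open>A\<close> form a basis, so the entries of \<open>f(A + \<epsilon> E) - f(A)\<close> tend to \<open>0\<close>; the
  eigenvectors of the perturbed matrices, which may vary wildly, never enter.
\<close>

lemma mat_fun_tendsto:
  assumes A: "hermitian_on m {a..b} A" and E: "hermitian_mat m E"
    and B: "\<And>\<epsilon>. 0 < \<epsilon> \<Longrightarrow> \<epsilon> \<le> \<epsilon>0 \<Longrightarrow> hermitian_on m {a..b} (A + complex_of_real \<epsilon> \<cdot>\<^sub>m E)" and "\<epsilon>0 > 0"
    and f: "continuous_on {a..b} f" and x: "dim_row x = m" "dim_col x = 1"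
  shows "((\<lambda>\<epsilon>. qf (mat_fun f (A + complex_of_real \<epsilon> \<cdot>\<^sub>m E)) x) \<longlongrightarrow> qf (mat_fun f A) x) (at_right 0)"
proof -
  note hA = hermitian_on_hermitian[OF A]
  obtain U d where U: "unitary_mat m U" "A = U * real_diag m d * U\<^sup>\<dagger>" "\<And>i. i < m \<Longrightarrow> d i \<in> {a..b}"
    using hermitian_on_spectral[OF A] by blast
  have [simp]: "dim_row U = m" "dim_col U = m" using unitary_mat_dim[OF U(1)] by auto
  note UU = unitary_mat_dim(3,4)[OF U(1)]
  note [simp] = hermitian_mat_dim(1,2)[OF E] hermitian_mat_dim(1,2)[OF hA] dim_mat_fun(1,2)[OF hA]
  define G where "G = (\<lambda>\<epsilon>. mat_fun f (A + complex_of_real \<epsilon> \<cdot>\<^sub>m E) - mat_fun f A)"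
  have hB: "hermitian_mat m (A + complex_of_real \<epsilon> \<cdot>\<^sub>m E)" for \<epsilon>
    using hermitian_mat_dim[OF E] hermitian_mat_dim[OF hA] by (intro hermitian_matI) auto
  note [simp] = dim_mat_fun(1,2)[OF hB]
  have [simp]: "dim_row (G \<epsilon>) = m" "dim_col (G \<epsilon>) = m" for \<epsilon> by (auto simp: G_def)
  define y where "y = U\<^sup>\<dagger> * x"
  have [simp]: "dim_row y = m" "dim_col y = 1" using x by (auto simp: y_def)
  have entry: "((\<lambda>\<epsilon>. (G \<epsilon> * U) $$ (j,i)) \<longlongrightarrow> 0) (at_right 0)" if ij: "i < m" "j < m" for i j
  proof -
    define u where "u = U * embed m 1 i"
    have u: "dim_row u = m" "dim_col u = 1" by (auto simp: u_def)
    have "u\<^sup>\<dagger> * u = 1\<^sub>m 1" using ij embed_isometry[of i 1 m]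
      by (simp add: u_def mat_expand mult_cancel_dim[OF UU(1)])
    then have one: "qf (1\<^sub>m m) u = 1" using u by (simp add: qf_def one_mult_dim)
    have "real_diag m d * embed m 1 i = complex_of_real (d i) \<cdot>\<^sub>m embed m 1 i"
      by (subst mat_diag_mult_left[of _ m 1]) (auto simp: index_embed intro!: eq_matI carrier_matI)
    then have Au: "A * u = complex_of_real (d i) \<cdot>\<^sub>m u"
      by (simp add: U(2) u_def mat_expand mult_cancel_dim[OF UU(1)])
    have lim: "((\<lambda>\<epsilon>. sqrt (qf (1\<^sub>m m) (G \<epsilon> * u))) \<longlongrightarrow> 0) (at_right 0)"
      using tendsto_real_sqrt[OF mat_fun_tendsto_eigenvector[OF A E B \<open>\<epsilon>0 > 0\<close> f u Au U(3)[OF ij(1)] one]]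
      by (simp add: G_def)
    show ?thesis
    proof (rule tendsto_0_le[OF lim always_eventually, of _ 1], rule allI)
      fix \<epsilon>
      have nonneg: "0 \<le> qf (1\<^sub>m m) (G \<epsilon> * u)" using u by (intro qf_one_nonneg) auto
      have "(G \<epsilon> * U) $$ (j,i) = (G \<epsilon> * u) $$ (j,0)"
        using index_mult_embed[of "G \<epsilon> * U" m j i] ij by (simp add: u_def mat_expand del: index_mult_mat(1))
      moreover have "(cmod ((G \<epsilon> * u) $$ (j,0)))\<^sup>2 \<le> qf (1\<^sub>m m) (G \<epsilon> * u)"
        using ij u by (subst qf_one) (auto simp del: index_mult_mat(1) intro!: member_le_sum)
      then have "cmod ((G \<epsilon> * u) $$ (j,0)) \<le> sqrt (qf (1\<^sub>m m) (G \<epsilon> * u))" by (rule real_le_rsqrt)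
      ultimately show "norm ((G \<epsilon> * U) $$ (j,i)) \<le> norm (sqrt (qf (1\<^sub>m m) (G \<epsilon> * u))) * 1"
        using nonneg by (simp del: index_mult_mat(1))
    qed
  qed
  have form: "(x\<^sup>\<dagger> * (G \<epsilon> * x)) $$ (0,0) = (\<Sum>j<m. cnj (x $$ (j,0)) * (\<Sum>i<m. (G \<epsilon> * U) $$ (j,i) * y $$ (i,0)))" for \<epsilon>
  proof -
    have "G \<epsilon> * x = (G \<epsilon> * U) * y" using x by (simp add: y_def mat_expand mult_cancel_dim[OF UU(2)])
    then show ?thesis using x by (simp add: scalar_prod_def[of "row (x\<^sup>\<dagger>) 0"] scalar_prod_def[of _ "col y 0"] lessThan_atLeast0)
  qed
  have "((\<lambda>\<epsilon>. \<Sum>j<m. cnj (x $$ (j,0)) * (\<Sum>i<m. (G \<epsilon> * U) $$ (j,i) * y $$ (i,0))) \<longlongrightarrow>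
      (\<Sum>j<m. cnj (x $$ (j,0)) * (\<Sum>i<m. 0 * y $$ (i,0)))) (at_right 0)"
    by (intro tendsto_intros entry) auto
  then have "((\<lambda>\<epsilon>. qf (G \<epsilon>) x) \<longlongrightarrow> 0) (at_right 0)"
    unfolding qf_def form using tendsto_Re by fastforce
  moreover have "qf (G \<epsilon>) x = qf (mat_fun f (A + complex_of_real \<epsilon> \<cdot>\<^sub>m E)) x - qf (mat_fun f A) x" for \<epsilon>
    using x unfolding G_def by (intro qf_minus) auto
  ultimately show ?thesis by (simp add: LIM_zero_iff)
qed

section \<open>Rank-one contractions and dilation\<close>

text \<open>
  Finitely many eigenvalues stay away from \<open>\<alpha>\<close>, so closed intervals and the quadratic form criterion
  apply.
\<close>

lemma hermitian_on_half_open: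
  assumes A: "hermitian_on m {0..<\<alpha>} A" and "\<alpha> > 0"
  obtains r where "0 \<le> r" "r < \<alpha>" "hermitian_on m {0..r} A"
proof -
  obtain U d where U: "unitary_mat m U" "A = U * real_diag m d * U\<^sup>\<dagger>" "\<And>i. i < m \<Longrightarrow> d i \<in> {0..<\<alpha>}"
    using hermitian_on_spectral[OF A] by blast
  let ?S = "insert 0 (d ` {..<m})"
  have "hermitian_on m {0..Max ?S} A" unfolding hermitian_on_dec[OF U(1,2)] using U(3) by auto
  moreover have "Max ?S < \<alpha>" using U(3) \<open>\<alpha> > 0\<close> by auto
  moreover have "0 \<le> Max ?S" by simp
  ultimately show thesis using that by blast
qed

lemma hermitian_on_open:
  assumes A: "hermitian_on m {0<..<\<alpha>} A" and "\<alpha> > 0"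
  obtains e r where "0 < e" "r < \<alpha>" "hermitian_on m {e..r} A"
proof -
  obtain U d where U: "unitary_mat m U" "A = U * real_diag m d * U\<^sup>\<dagger>" "\<And>i. i < m \<Longrightarrow> d i \<in> {0<..<\<alpha>}"
    using hermitian_on_spectral[OF A] by blast
  let ?S = "insert (\<alpha> / 2) (d ` {..<m})"
  have "hermitian_on m {Min ?S..Max ?S} A" unfolding hermitian_on_dec[OF U(1,2)] by auto
  moreover have "Max ?S < \<alpha>" "0 < Min ?S" using U(3) \<open>\<alpha> > 0\<close> by auto
  ultimately show thesis using that by blast
qed

lemma hermitian_on_contraction_congruence:
  assumes A: "hermitian_on m {0..r} A" and "0 \<le> r"
    and C: "dim_row C = m" "dim_col C = k" "loewner_le k (C\<^sup>\<dagger> * C) (1\<^sub>m k)"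
  shows "hermitian_on k {0..r} (C\<^sup>\<dagger> * A * C)"
proof -
  note hA = hermitian_on_hermitian[OF A]
  note [simp] = hermitian_mat_dim[OF hA]
  show ?thesis unfolding hermitian_on_interval_iff
  proof (intro conjI allI impI)
    show "hermitian_mat k (C\<^sup>\<dagger> * A * C)" using hermitian_congruence[OF hA] C by blast
    fix x :: "complex mat" assume x: "dim_row x = k" "dim_col x = 1"
    have eq: "qf (C\<^sup>\<dagger> * A * C) x = qf A (C * x)" using x C by (intro qf_congruence[of _ m _ k]) auto
    have Cx: "dim_row (C * x) = m" "dim_col (C * x) = 1" using x C by auto
    have A1: "0 * qf (1\<^sub>m m) (C * x) \<le> qf A (C * x)" "qf A (C * x) \<le> r * qf (1\<^sub>m m) (C * x)"
      using A Cx unfolding hermitian_on_interval_iff by blast+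
    show "0 * qf (1\<^sub>m k) x \<le> qf (C\<^sup>\<dagger> * A * C) x" unfolding eq using A1 by simp
    have "qf (1\<^sub>m m) (C * x) = qf (C\<^sup>\<dagger> * C) x" using x C by (intro qf_gram[symmetric]) auto
    also have "\<dots> \<le> qf (1\<^sub>m k) x" using C x unfolding loewner_le_iff by blast
    finally have "r * qf (1\<^sub>m m) (C * x) \<le> r * qf (1\<^sub>m k) x" using \<open>0 \<le> r\<close> by (rule mult_left_mono)
    then show "qf (C\<^sup>\<dagger> * A * C) x \<le> r * qf (1\<^sub>m k) x" unfolding eq using A1 by linarith
  qed
qed

text \<open>
  The positive square root of \<open>1 - w w\<^sup>\<dagger>\<close> for \<open>w\<^sup>\<dagger> w = p \<le> 1\<close>. The coefficient is
  \<open>(1 - \<surd>(1 - p)) / p\<close>, written so that \<open>p = 0\<close> is no exception.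
\<close>

definition defect_root :: "nat \<Rightarrow> complex mat \<Rightarrow> real \<Rightarrow> complex mat" where
  "defect_root n w p = 1\<^sub>m n - complex_of_real (1 / (1 + sqrt (1 - p))) \<cdot>\<^sub>m (w * w\<^sup>\<dagger>)"

lemma defect_root:
  assumes w: "dim_row w = n" "dim_col w = 1" "w\<^sup>\<dagger> * w = complex_of_real p \<cdot>\<^sub>m 1\<^sub>m 1" and p: "p \<le> 1"
  shows "dim_row (defect_root n w p) = n" "dim_col (defect_root n w p) = n"
    "(defect_root n w p)\<^sup>\<dagger> = defect_root n w p"
    "defect_root n w p * w = complex_of_real (sqrt (1 - p)) \<cdot>\<^sub>m w"
    "w\<^sup>\<dagger> * defect_root n w p = complex_of_real (sqrt (1 - p)) \<cdot>\<^sub>m w\<^sup>\<dagger>"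
    "defect_root n w p * defect_root n w p = 1\<^sub>m n - w * w\<^sup>\<dagger>"
proof -
  let ?R = "defect_root n w p"
  define c where "c = sqrt (1 - p)"
  define t where "t = 1 / (1 + c)"
  have "c \<ge> 0" and pc: "p = 1 - c\<^sup>2" using p by (auto simp: c_def)
  then have "1 - t * p = c" by (simp add: t_def field_simps power2_eq_square)
  have tc: "t + t * c = 1" using \<open>c \<ge> 0\<close> by (simp add: t_def field_simps)
  have R: "?R = 1\<^sub>m n - complex_of_real t \<cdot>\<^sub>m (w * w\<^sup>\<dagger>)" by (simp add: defect_root_def t_def c_def)
  show d: "dim_row ?R = n" "dim_col ?R = n" using w by (auto simp: R)
  show a: "?R\<^sup>\<dagger> = ?R" using w by (simp add: R)
  have "?R * w = complex_of_real (1 - t * p) \<cdot>\<^sub>m w"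
    using w unfolding R by (auto simp: mat_expand algebra_simps simp del: index_mult_mat(1) intro!: eq_matI)
  then show Rw: "?R * w = complex_of_real (sqrt (1 - p)) \<cdot>\<^sub>m w" using \<open>1 - t * p = c\<close> by (simp add: c_def)
  show "w\<^sup>\<dagger> * ?R = complex_of_real (sqrt (1 - p)) \<cdot>\<^sub>m w\<^sup>\<dagger>"
    using arg_cong[OF Rw, of mat_adjoint] d w by (simp add: a)
  have "?R * ?R = ?R - complex_of_real t \<cdot>\<^sub>m ((?R * w) * w\<^sup>\<dagger>)"
    using d w by (subst (2) R) (simp add: mat_expand)
  also have "\<dots> = 1\<^sub>m n - complex_of_real (t + t * c) \<cdot>\<^sub>m (w * w\<^sup>\<dagger>)"
    unfolding Rw c_def[symmetric] unfolding R using w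
    by (auto simp: mat_expand algebra_simps simp del: index_mult_mat(1) intro!: eq_matI)
  finally show "?R * ?R = 1\<^sub>m n - w * w\<^sup>\<dagger>" unfolding tc using w
    by (auto simp del: index_mult_mat(1) intro!: eq_matI)
qed

text \<open>
  The contraction inequality for the square roots \<open>R\<close> of \<open>1 - w w\<^sup>\<dagger>\<close> alone; both the concavity and the
  contraction inequality for all \<open>C\<close> imply it, and it implies monotonicity.
\<close>

definition rank_one_contraction_ineq :: "nat \<Rightarrow> real set \<Rightarrow> (real \<Rightarrow> real) \<Rightarrow> bool" where
  "rank_one_contraction_ineq n I f \<longleftrightarrow>
    (\<forall>A w p. hermitian_on n I A \<longrightarrow> dim_row w = n \<longrightarrow> dim_col w = 1 \<longrightarrow>
      w\<^sup>\<dagger> * w = complex_of_real p \<cdot>\<^sub>m 1\<^sub>m 1 \<longrightarrow> p \<le> 1 \<longrightarrow>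
      loewner_le n (defect_root n w p * mat_fun f A * defect_root n w p)
        (mat_fun f (defect_root n w p * A * defect_root n w p)))"


lemma contraction_ineq_imp_rank_one:
  assumes "matrix_contraction_ineq n I f"
  shows "rank_one_contraction_ineq n I f"
  unfolding rank_one_contraction_ineq_def
proof (intro allI impI)
  fix A w :: "complex mat" and p :: real
  assume A: "hermitian_on n I A" and w: "dim_row w = n" "dim_col w = 1" "w\<^sup>\<dagger> * w = complex_of_real p \<cdot>\<^sub>m 1\<^sub>m 1"
    and p: "p \<le> 1"
  note R = defect_root[OF w p]
  have "contraction_mat n (defect_root n w p)"
    unfolding contraction_mat_iff
  proof (intro conjI allI impI)
    fix x :: "complex mat" assume x: "dim_row x = n" "dim_col x = 1"
    have "qf (w * w\<^sup>\<dagger>) x = qf (1\<^sub>m 1) (w\<^sup>\<dagger> * x)" using qf_gram[of "w\<^sup>\<dagger>" n x 1] w x by simp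
    also have "\<dots> \<ge> 0" using w x by (intro qf_one_nonneg) auto
    finally show "qf ((defect_root n w p)\<^sup>\<dagger> * defect_root n w p) x \<le> qf (1\<^sub>m n) x"
      using w x by (simp add: R qf_minus[of _ n])
  qed (use R in auto)
  then have "loewner_le n ((defect_root n w p)\<^sup>\<dagger> * mat_fun f A * defect_root n w p)
      (mat_fun f ((defect_root n w p)\<^sup>\<dagger> * A * defect_root n w p))"
    using assms A unfolding matrix_contraction_ineq_def by simp
  then show "loewner_le n (defect_root n w p * mat_fun f A * defect_root n w p)
      (mat_fun f (defect_root n w p * A * defect_root n w p))"
    unfolding R(3) .
qed

text \<open>
  Let \<open>J\<close> embed \<open>\<complex>\<^sup>n\<close> into \<open>\<complex>\<^bsup>n+1\<^esup>\<close> with complement spanned by the unit vector \<open>e\<close>, and let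
  \<open>c = \<surd>(1 - p)\<close>. For \<open>s = \<plusminus> 1\<close> the matrix \<open>U\<close> that acts on \<open>\<complex>\<^sup>n\<close> as \<open>T = J R + s e w\<^sup>\<dagger>\<close> and sends
  \<open>e\<close> to \<open>c e - s J w\<close> is unitary, because \<open>R\<^sup>2 + w w\<^sup>\<dagger> = 1\<close>, \<open>R w = c w\<close> and \<open>p + c\<^sup>2 = 1\<close>.
  The terms linear in \<open>s\<close> cancel in the mean of the two conjugates of \<open>A \<oplus> 0\<close>.
\<close>

lemma concave_imp_rank_one:
  assumes conc: "matrix_concave (n + 1) {0..<\<alpha>} f" and f0: "f 0 \<ge> 0" and "\<alpha> > 0"
  shows "rank_one_contraction_ineq n {0..<\<alpha>} f"
  unfolding rank_one_contraction_ineq_def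
proof (intro allI impI)
  fix A w :: "complex mat" and p :: real
  assume A: "hermitian_on n {0..<\<alpha>} A" and w: "dim_row w = n" "dim_col w = 1" "w\<^sup>\<dagger> * w = complex_of_real p \<cdot>\<^sub>m 1\<^sub>m 1"
    and p: "p \<le> 1"
  note hA = hermitian_on_hermitian[OF A]
  define R where "R = defect_root n w p"
  define c where "c = sqrt (1 - p)"
  have cc: "c * c = 1 - p" using p by (simp add: c_def)
  note R = defect_root[OF w p, folded R_def c_def]
  obtain r where r: "0 \<le> r" "r < \<alpha>" "hermitian_on n {0..r} A"
    using hermitian_on_half_open[OF A \<open>\<alpha> > 0\<close>] .
  define J where "J = embed (Suc n) n 1"
  define e where "e = embed (Suc n) 1 0"
  have [simp]: "dim_row e = Suc n" "dim_col e = 1" "dim_row J = Suc n" "dim_col J = n"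
    by (auto simp: e_def J_def)
  note [simp] = R(1,2) w(1,2) hermitian_mat_dim[OF hA] dim_mat_fun[OF hA]
  have ee: "e\<^sup>\<dagger> * e = 1\<^sub>m 1" and JJ: "J\<^sup>\<dagger> * J = 1\<^sub>m n" and eJ: "e\<^sup>\<dagger> * J = 0\<^sub>m 1 n" and Je: "J\<^sup>\<dagger> * e = 0\<^sub>m n 1"
    unfolding e_def J_def by (auto intro!: embed_isometry embed_orthogonal)
  have res: "e * e\<^sup>\<dagger> + J * J\<^sup>\<dagger> = 1\<^sub>m (Suc n)" unfolding e_def J_def by (rule embed_resolution)
  note canc = ee JJ eJ Je mult_cancel_dim[OF ee] mult_cancel_dim[OF JJ] zero_cancel_dim[OF eJ] zero_cancel_dim[OF Je]
    R(3-6)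
  have wc: "w\<^sup>\<dagger> * (w * X) = complex_of_real p \<cdot>\<^sub>m X" if "dim_row X = 1" for X
    using smult_cancel_dim[OF w(3)] that by simp
  have Rw: "R * (w * X) = complex_of_real c \<cdot>\<^sub>m (w * X)" if "dim_row X = 1" for X
    using that R(4) by (simp flip: mult_assoc_dim add: smult_mult_dim)
  have wR: "w\<^sup>\<dagger> * (R * X) = complex_of_real c \<cdot>\<^sub>m (w\<^sup>\<dagger> * X)" if "dim_row X = n" for X
    using that R(5) by (simp flip: mult_assoc_dim add: smult_mult_dim)
  have RR: "R * (R * X) = X - w * (w\<^sup>\<dagger> * X)" if "dim_row X = n" for X
    using that R(6) by (simp flip: mult_assoc_dim) (simp add: mat_expand)
  define At where "At = J * A * J\<^sup>\<dagger>"
  have [simp]: "dim_row At = Suc n" "dim_col At = Suc n" by (auto simp: At_def)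
  have AtJ: "At * J = J * A" by (simp add: At_def mat_expand canc)
  have Ate: "At * e = e * (complex_of_real 0 \<cdot>\<^sub>m 1\<^sub>m 1)" by (auto simp: At_def mat_expand canc intro!: eq_matI)
  have "loewner_le (Suc n) (J * J\<^sup>\<dagger>) (1\<^sub>m (Suc n))"
    using loewner_gram_swap[of J "Suc n" n] by (simp add: JJ loewner_le_refl hermitian_matI)
  then have At: "hermitian_on (Suc n) {0..r} At"
    using hermitian_on_contraction_congruence[OF r(3,1), of "J\<^sup>\<dagger>" "Suc n"] by (simp add: At_def)
  note hAt = hermitian_on_hermitian[OF At]
  note [simp] = dim_mat_fun[OF hAt]
  have fJ: "mat_fun f At * J = J * mat_fun f A"
    by (intro mat_fun_intertwine[OF hAt hA] AtJ) auto
  have fe: "mat_fun f At * e = complex_of_real (f 0) \<cdot>\<^sub>m e"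
    using mat_fun_intertwine[OF hAt hermitian_scalar _ _ Ate, of f] unfolding mat_fun_scalar by (simp add: mat_expand)
  define T where "T = (\<lambda>s::real. J * R + complex_of_real s \<cdot>\<^sub>m (e * w\<^sup>\<dagger>))"
  define U where "U = (\<lambda>s::real. T s * J\<^sup>\<dagger> + (complex_of_real c \<cdot>\<^sub>m e - complex_of_real s \<cdot>\<^sub>m (J * w)) * e\<^sup>\<dagger>)"
  have [simp]: "dim_row (T s) = Suc n" "dim_col (T s) = n" "dim_row (U s) = Suc n" "dim_col (U s) = Suc n" for s
    by (auto simp: T_def U_def)
  have UJ: "U s * J = T s" for s
    unfolding U_def by (simp add: mat_expand canc) (auto simp del: index_mult_mat(1) intro!: eq_matI)
  have U'J: "(U s)\<^sup>\<dagger> * J = J * R - complex_of_real s \<cdot>\<^sub>m (e * w\<^sup>\<dagger>)" for s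
    unfolding U_def T_def by (simp add: mat_expand canc) (auto simp del: index_mult_mat(1) intro!: eq_matI)
  have isom: "(U s)\<^sup>\<dagger> * U s = 1\<^sub>m (Suc n)" if s: "s * s = 1" for s
  proof -
    have ss: "complex_of_real s * complex_of_real s = 1" "complex_of_real c * complex_of_real c = 1 - complex_of_real p"
      using s cc by (metis of_real_mult of_real_1, metis of_real_mult of_real_1 of_real_diff)
    have ss': "complex_of_real s * (complex_of_real s * z) = z"
      "complex_of_real c * (complex_of_real c * z) = z - complex_of_real p * z" for z
      by (simp_all only: mult.assoc[symmetric] ss) (simp_all add: algebra_simps)
    have "(U s)\<^sup>\<dagger> * U s = e * e\<^sup>\<dagger> + J * J\<^sup>\<dagger>"
      unfolding U_def T_def
      by (simp add: mat_expand canc wc Rw wR RR w(3))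
        (auto simp: ss' algebra_simps simp del: index_mult_mat(1) intro!: eq_matI)
    then show ?thesis using res by simp
  qed
  define M where "M = (\<lambda>s. (U s)\<^sup>\<dagger> * At * U s)"
  have [simp]: "dim_row (M s) = Suc n" "dim_col (M s) = Suc n" for s by (auto simp: M_def)
  have M: "hermitian_on (Suc n) {0..<\<alpha>} (M s)" if s: "s * s = 1" for s
  proof -
    have "hermitian_on (Suc n) {0..r} (M s)" unfolding M_def using isom[OF s]
      by (intro hermitian_on_contraction_congruence[OF At r(1)]) (auto simp: loewner_le_refl hermitian_matI)
    then show ?thesis by (rule hermitian_on_mono) (use r in auto)
  qed
  \<comment> \<open>\<open>f\<close> of the conjugate is the conjugate of \<open>f(A) \<oplus> f(0)\<close>; this is where \<open>f(0)\<close> enters\<close>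
  have fM: "J\<^sup>\<dagger> * mat_fun f (M s) * J = R * mat_fun f A * R + complex_of_real (f 0) \<cdot>\<^sub>m (w * w\<^sup>\<dagger>)" if s: "s * s = 1" for s
  proof -
    note hM = hermitian_on_hermitian[OF M[OF s]]
    note [simp] = dim_mat_fun[OF hM]
    have "U s * (U s)\<^sup>\<dagger> = 1\<^sub>m (Suc n)"
      by (rule mat_mult_left_right_inverse[OF _ _ isom[OF s]]) (auto intro: carrier_matI)
    then have "At * U s = U s * M s" by (simp add: M_def mat_expand mult_cancel_dim)
    then have "mat_fun f At * U s = U s * mat_fun f (M s)" by (intro mat_fun_intertwine[OF hAt hM]) auto
    then have "mat_fun f (M s) = (U s)\<^sup>\<dagger> * (mat_fun f At * U s)" by (simp add: mult_cancel_dim[OF isom[OF s]])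
    then have "J\<^sup>\<dagger> * mat_fun f (M s) * J = (U s * J)\<^sup>\<dagger> * (mat_fun f At * (U s * J))" by (simp add: mat_expand)
    also have "mat_fun f At * (U s * J) = J * mat_fun f A * R + complex_of_real (s * f 0) \<cdot>\<^sub>m (e * w\<^sup>\<dagger>)"
    proof -
      have "mat_fun f At * T s = (mat_fun f At * J) * R + complex_of_real s \<cdot>\<^sub>m ((mat_fun f At * e) * w\<^sup>\<dagger>)"
        by (simp add: T_def mat_expand)
      then show ?thesis unfolding UJ fJ fe by (simp add: mat_expand)
    qed
    also have "(U s * J)\<^sup>\<dagger> * \<dots> = R * mat_fun f A * R + complex_of_real (s * s * f 0) \<cdot>\<^sub>m (w * w\<^sup>\<dagger>)"
      unfolding UJ T_def by (simp add: mat_expand canc) (auto simp del: index_mult_mat(1) intro!: eq_matI)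
    finally show ?thesis by (simp add: s)
  qed
  define L where "L = complex_of_real (1/2) \<cdot>\<^sub>m M 1 + complex_of_real (1 - 1/2) \<cdot>\<^sub>m M (-1)"
  have "loewner_le (n + 1)
      (complex_of_real (1/2) \<cdot>\<^sub>m mat_fun f (M 1) + complex_of_real (1 - 1/2) \<cdot>\<^sub>m mat_fun f (M (-1))) (mat_fun f L)"
    unfolding L_def by (rule conc[unfolded matrix_concave_def, rule_format]) (use M[of 1] M[of "-1"] in auto)
  from loewner_le_congruence[OF this, of J n]
  have le: "loewner_le n (J\<^sup>\<dagger> * (complex_of_real (1/2) \<cdot>\<^sub>m mat_fun f (M 1) + complex_of_real (1 - 1/2) \<cdot>\<^sub>m mat_fun f (M (-1))) * J)
      (J\<^sup>\<dagger> * mat_fun f L * J)" by simp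
  have hM: "hermitian_mat (Suc n) (M 1)" "hermitian_mat (Suc n) (M (-1))"
    using hermitian_on_hermitian[OF M] by auto
  have hL: "hermitian_mat (Suc n) L"
    using hermitian_mat_dim(3)[OF hM(1)] hermitian_mat_dim(3)[OF hM(2)] unfolding L_def by (intro hermitian_matI) auto
  have MJ: "M s * J = J * R * A * R - complex_of_real s \<cdot>\<^sub>m (e * w\<^sup>\<dagger> * A * R)" for s
  proof -
    have "At * T s = (At * J) * R + complex_of_real s \<cdot>\<^sub>m ((At * e) * w\<^sup>\<dagger>)" by (simp add: T_def mat_expand)
    also have "\<dots> = J * A * R" unfolding AtJ Ate by (auto simp: mat_expand simp del: index_mult_mat(1) intro!: eq_matI)
    finally have "M s * J = ((U s)\<^sup>\<dagger> * J) * (A * R)" by (simp add: M_def mat_expand UJ)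
    then show ?thesis unfolding U'J by (simp add: mat_expand)
  qed
  \<comment> \<open>the range of \<open>J\<close> is invariant under the mean, so \<open>f\<close> of the mean restricts to \<open>f(R A R)\<close>\<close>
  have LJ: "L * J = J * (R * A * R)"
    unfolding L_def by (simp add: mat_expand MJ) (auto simp: mat_expand add_divide_distrib diff_divide_distrib simp del: index_mult_mat(1) intro!: eq_matI)
  have hRAR: "hermitian_mat n (R * A * R)" using hermitian_congruence[OF hA, of R n] R by simp
  have fL: "J\<^sup>\<dagger> * mat_fun f L * J = mat_fun f (R * A * R)"
    using mat_fun_intertwine[OF hL hRAR _ _ LJ, of f] dim_mat_fun[OF hL] dim_mat_fun[OF hRAR]
    by (simp add: mat_expand canc)
  have "J\<^sup>\<dagger> * (complex_of_real (1/2) \<cdot>\<^sub>m mat_fun f (M 1) + complex_of_real (1 - 1/2) \<cdot>\<^sub>m mat_fun f (M (-1))) * J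
      = complex_of_real (1/2) \<cdot>\<^sub>m (J\<^sup>\<dagger> * mat_fun f (M 1) * J) + complex_of_real (1 - 1/2) \<cdot>\<^sub>m (J\<^sup>\<dagger> * mat_fun f (M (-1)) * J)"
    using dim_mat_fun[OF hM(1)] dim_mat_fun[OF hM(2)] by (simp add: mat_expand)
  also have "\<dots> = R * mat_fun f A * R + complex_of_real (f 0) \<cdot>\<^sub>m (w * w\<^sup>\<dagger>)"
    by (simp add: fM) (auto simp: field_simps simp del: index_mult_mat(1) intro!: eq_matI)
  finally have le': "loewner_le n (R * mat_fun f A * R + complex_of_real (f 0) \<cdot>\<^sub>m (w * w\<^sup>\<dagger>)) (mat_fun f (R * A * R))"
    using le unfolding fL by simp
  have "loewner_le n (R * mat_fun f A * R) (R * mat_fun f A * R + complex_of_real (f 0) \<cdot>\<^sub>m (w * w\<^sup>\<dagger>))"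
  proof (intro loewner_leI)
    show "hermitian_mat n (R * mat_fun f A * R)" using hermitian_congruence[OF hermitian_mat_fun[OF hA], of R n f] R by simp
    show "hermitian_mat n (R * mat_fun f A * R + complex_of_real (f 0) \<cdot>\<^sub>m (w * w\<^sup>\<dagger>))"
      using le' by (simp add: loewner_le_iff)
    fix x :: "complex mat" assume x: "dim_row x = n" "dim_col x = 1"
    have "qf (w * w\<^sup>\<dagger>) x = qf (1\<^sub>m 1) (w\<^sup>\<dagger> * x)" using qf_gram[of "w\<^sup>\<dagger>" n x 1] w x by simp
    also have "\<dots> \<ge> 0" using w x by (intro qf_one_nonneg) auto
    finally have "0 \<le> f 0 * qf (w * w\<^sup>\<dagger>) x" using f0 by simp
    then show "qf (R * mat_fun f A * R) x \<le> qf (R * mat_fun f A * R + complex_of_real (f 0) \<cdot>\<^sub>m (w * w\<^sup>\<dagger>)) x"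
      using x by (simp add: qf_add[of _ n] qf_smult[of _ n])
  qed
  then show "loewner_le n (defect_root n w p * mat_fun f A * defect_root n w p)
      (mat_fun f (defect_root n w p * A * defect_root n w p))"
    unfolding R_def[symmetric] using le' by (rule loewner_le_trans)
qed

section \<open>From rank-one contractions to monotonicity\<close>

lemma gram_scalar:
  assumes w: "dim_row w = n" "dim_col w = 1"
  shows "w\<^sup>\<dagger> * w = complex_of_real (qf (1\<^sub>m n) w) \<cdot>\<^sub>m 1\<^sub>m 1"
proof -
  have h: "hermitian_mat n (1\<^sub>m n)" by (intro hermitian_matI) auto
  have "(w\<^sup>\<dagger> * w) $$ (0,0) = complex_of_real (qf (1\<^sub>m n) w)"
    using form_real[OF h w] w by (simp add: one_mult_dim)
  then show ?thesis using w by (intro eq_matI) (auto simp del: index_mult_mat(1))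
qed

lemma qf_gram_nonneg:
  assumes "dim_row w = n" "dim_row x = n" "dim_col x = 1"
  shows "0 \<le> qf (w * w\<^sup>\<dagger>) x"
proof -
  have "qf (w * w\<^sup>\<dagger>) x = qf (1\<^sub>m (dim_col w)) (w\<^sup>\<dagger> * x)" using qf_gram[of "w\<^sup>\<dagger>" n x "dim_col w"] assms by simp
  also have "\<dots> \<ge> 0" using assms by (intro qf_one_nonneg) auto
  finally show ?thesis .
qed

lemma mat_fun_sqrt_inverse:
  assumes B: "hermitian_on n I B" and I: "\<And>t. t \<in> I \<Longrightarrow> t > 0"
  shows "mat_fun sqrt B * mat_fun sqrt B = B"
    "mat_fun sqrt B * mat_fun (\<lambda>t. 1 / sqrt t) B = 1\<^sub>m n"
    "mat_fun (\<lambda>t. 1 / sqrt t) B * mat_fun sqrt B = 1\<^sub>m n"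
proof -
  note hB = hermitian_on_hermitian[OF B]
  have one: "mat_fun (\<lambda>_. 1) B = 1\<^sub>m n" by (auto simp: mat_fun_const[OF hB] intro!: eq_matI)
  have "mat_fun sqrt B * mat_fun sqrt B = mat_fun (\<lambda>t. t) B"
    unfolding mat_fun_mult[OF hB] by (intro mat_fun_cong[OF B]; use I in force)
  then show "mat_fun sqrt B * mat_fun sqrt B = B" by (simp add: mat_fun_id[OF hB])
  show "mat_fun sqrt B * mat_fun (\<lambda>t. 1 / sqrt t) B = 1\<^sub>m n"
    unfolding mat_fun_mult[OF hB] one[symmetric] by (intro mat_fun_cong[OF B]; use I in force)
  show "mat_fun (\<lambda>t. 1 / sqrt t) B * mat_fun sqrt B = 1\<^sub>m n"
    unfolding mat_fun_mult[OF hB] one[symmetric] by (intro mat_fun_cong[OF B]; use I in force)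
qed

text \<open>
  For \<open>w = B\<^bsup>-1/2\<^esup> x\<close>, \<open>R = (1 - w w\<^sup>\<dagger>)\<^bsup>1/2\<^esup>\<close> and \<open>Z = B\<^bsup>1/2\<^esup> R\<close> one has \<open>Z Z\<^sup>\<dagger> = A\<close>, \<open>Z\<^sup>\<dagger> Z = R B R\<close> and
  \<open>Z R = A B\<^bsup>-1/2\<^esup>\<close>. Conjugating the inequality \<open>R f(B) R \<le> f(R B R)\<close> by \<open>Z\<close> therefore gives
  \<open>A B\<^bsup>-1/2\<^esup> f(B) B\<^bsup>-1/2\<^esup> A \<le> f(A) A\<close>, from which \<open>A\<close> is cancelled on both sides.
\<close>

lemma rank_one_increment_antimono:
  assumes ineq: "rank_one_contraction_ineq n {0..<\<alpha>} f" and "\<alpha> > 0"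
    and A: "hermitian_on n {0<..<\<alpha>} A" and B: "hermitian_on n {0<..<\<alpha>} B"
    and x: "dim_row x = n" "dim_col x = 1" and AB: "A = B - x * x\<^sup>\<dagger>"
  shows "loewner_le n (mat_fun (\<lambda>t. f t / t) B) (mat_fun (\<lambda>t. f t / t) A)"
proof -
  note hA = hermitian_on_hermitian[OF A] and hB = hermitian_on_hermitian[OF B]
  define S where "S = mat_fun sqrt B"
  define S' where "S' = mat_fun (\<lambda>t. 1 / sqrt t) B"
  have SS: "S * S = B" "S * S' = 1\<^sub>m n" "S' * S = 1\<^sub>m n"
    using mat_fun_sqrt_inverse[OF B] by (auto simp: S_def S'_def)
  note [simp] = hermitian_mat_dim[OF hA] hermitian_mat_dim[OF hB] dim_mat_fun[OF hA] dim_mat_fun[OF hB] x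
  have [simp]: "dim_row S = n" "dim_col S = n" "S\<^sup>\<dagger> = S" "dim_row S' = n" "dim_col S' = n" "S'\<^sup>\<dagger> = S'"
    by (auto simp: S_def S'_def)
  note canc = mult_cancel_dim[OF SS(2)] mult_cancel_dim[OF SS(3)] SS
  define w where "w = S' * x"
  have w: "dim_row w = n" "dim_col w = 1" by (auto simp: w_def)
  define p where "p = qf (1\<^sub>m n) w"
  have ww: "w\<^sup>\<dagger> * w = complex_of_real p \<cdot>\<^sub>m 1\<^sub>m 1" unfolding p_def by (rule gram_scalar[OF w])
  have "p \<ge> 0" unfolding p_def by (rule qf_one_nonneg[OF w])
  have S'AS': "S'\<^sup>\<dagger> * A * S' = 1\<^sub>m n - w * w\<^sup>\<dagger>"
    unfolding AB w_def by (simp add: mat_expand canc flip: SS(1))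
  \<comment> \<open>evaluate \<open>0 \<le> B\<^bsup>-1/2\<^esup> A B\<^bsup>-1/2\<^esup> = 1 - w w\<^sup>\<dagger>\<close> at \<open>w\<close> to get \<open>0 \<le> p - p\<^sup>2\<close>\<close>
  have "p \<le> 1"
  proof -
    obtain e r where er: "0 < e" "r < \<alpha>" "hermitian_on n {e..r} A" using hermitian_on_open[OF A \<open>\<alpha> > 0\<close>] .
    have "0 \<le> e * qf (1\<^sub>m n) (S' * w)" using er(1) w by (intro mult_nonneg_nonneg qf_one_nonneg) auto
    also have "\<dots> \<le> qf A (S' * w)" using er(3) w unfolding hermitian_on_interval_iff by simp
    also have "\<dots> = qf (S'\<^sup>\<dagger> * A * S') w" using w by (intro qf_congruence[symmetric, of _ n _ n]) auto
    also have "\<dots> = p - qf (w * w\<^sup>\<dagger>) w" unfolding S'AS' p_def using w by (intro qf_minus) auto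
    also have "qf (w * w\<^sup>\<dagger>) w = qf (1\<^sub>m 1) (w\<^sup>\<dagger> * w)" using qf_gram[of "w\<^sup>\<dagger>" n w 1] w by simp
    also have "\<dots> = p\<^sup>2 * qf (1\<^sub>m 1) (1\<^sub>m 1)" unfolding ww by (intro qf_scale) auto
    also have "qf (1\<^sub>m 1) (1\<^sub>m 1) = 1" by (simp add: qf_def one_mult_dim del: One_nat_def)
    finally have "0 \<le> p * (1 - p)" by (simp add: power2_eq_square algebra_simps)
    then show ?thesis using \<open>p \<ge> 0\<close> by (simp add: zero_le_mult_iff) linarith
  qed
  define R where "R = defect_root n w p"
  note R = defect_root[OF w ww \<open>p \<le> 1\<close>, folded R_def]
  note [simp] = R(1,2,3) w
  define Z where "Z = S * R"
  have [simp]: "dim_row Z = n" "dim_col Z = n" by (auto simp: Z_def)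
  have ZR: "Z * R = A * S'"
  proof -
    have "Z * R = S * (R * R)" by (simp add: Z_def mat_expand)
    also have "\<dots> = S - x * w\<^sup>\<dagger>" unfolding R(6) by (simp add: mat_expand w_def canc)
    also have "\<dots> = A * S'" unfolding AB by (simp add: mat_expand w_def canc flip: SS(1))
    finally show ?thesis .
  qed
  have ZZ: "Z * Z\<^sup>\<dagger> = A"
  proof -
    have "Z * Z\<^sup>\<dagger> = (Z * R) * S" by (simp add: Z_def mat_expand)
    then show ?thesis unfolding ZR by (simp add: mat_expand canc)
  qed
  have Z'Z: "Z\<^sup>\<dagger> * Z = R * B * R" by (simp add: Z_def mat_expand flip: SS(1))
  have hK: "hermitian_mat n (R * B * R)" using hermitian_congruence[OF hB, of R n] by simp
  note [simp] = dim_mat_fun[OF hK]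
  have fZ: "mat_fun f A * Z = Z * mat_fun f (R * B * R)"
    by (intro mat_fun_intertwine[OF hA hK]) (simp_all add: mat_expand flip: ZZ Z'Z)
  have B0: "hermitian_on n {0..<\<alpha>} B" using B by (rule hermitian_on_mono) auto
  have "loewner_le n (R * mat_fun f B * R) (mat_fun f (R * B * R))"
    using ineq B0 w ww \<open>p \<le> 1\<close> unfolding rank_one_contraction_ineq_def R_def by blast
  then have "loewner_le n ((Z\<^sup>\<dagger>)\<^sup>\<dagger> * (R * mat_fun f B * R) * Z\<^sup>\<dagger>) ((Z\<^sup>\<dagger>)\<^sup>\<dagger> * mat_fun f (R * B * R) * Z\<^sup>\<dagger>)"
    by (rule loewner_le_congruence) auto
  moreover have "(Z\<^sup>\<dagger>)\<^sup>\<dagger> * (R * mat_fun f B * R) * Z\<^sup>\<dagger> = (Z * R) * mat_fun f B * (Z * R)\<^sup>\<dagger>" by (simp add: mat_expand)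
  moreover have "(Z\<^sup>\<dagger>)\<^sup>\<dagger> * mat_fun f (R * B * R) * Z\<^sup>\<dagger> = mat_fun f A * A"
    using arg_cong[OF fZ, of "\<lambda>M. M * Z\<^sup>\<dagger>"] by (simp add: mat_expand ZZ)
  ultimately have le: "loewner_le n ((A * S') * mat_fun f B * (A * S')\<^sup>\<dagger>) (mat_fun f A * A)"
    unfolding ZR by simp
  define A' where "A' = mat_fun (\<lambda>t. 1 / t) A"
  have [simp]: "dim_row A' = n" "dim_col A' = n" "A'\<^sup>\<dagger> = A'" by (auto simp: A'_def)
  have A1: "mat_fun (\<lambda>t. t * (1 / t)) A = 1\<^sub>m n" 
    using mat_fun_cong[OF A, of "\<lambda>t. t * (1 / t)" "\<lambda>_. 1"] by (auto simp: mat_fun_const[OF hA] intro!: eq_matI)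
  have AA': "A * A' = 1\<^sub>m n" using mat_fun_mult[OF hA, of "\<lambda>t. t" "\<lambda>t. 1 / t"] A1 by (simp add: A'_def mat_fun_id[OF hA])
  have A'A: "A' * A = 1\<^sub>m n" using mat_fun_mult[OF hA, of "\<lambda>t. 1 / t" "\<lambda>t. t"] A1 by (simp add: A'_def mat_fun_id[OF hA] mult.commute)
  from loewner_le_congruence[OF le, of A' n]
  have "loewner_le n (S' * mat_fun f B * S') (A' * mat_fun f A)"
    by (simp add: mat_expand AA' A'A mult_cancel_dim[OF A'A])
  moreover have "S' * mat_fun f B * S' = mat_fun (\<lambda>t. f t / t) B"
    unfolding S'_def mat_fun_mult[OF hB] by (intro mat_fun_cong[OF B]) auto
  moreover have "A' * mat_fun f A = mat_fun (\<lambda>t. f t / t) A"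
    unfolding A'_def mat_fun_mult[OF hA] by simp
  ultimately show ?thesis by simp
qed

lemma psd_spectral:
  assumes "psd_mat n D"
  obtains V l where "unitary_mat n V" "D = V * real_diag n l * V\<^sup>\<dagger>" "\<And>i. i < n \<Longrightarrow> l i \<ge> 0"
proof -
  have h: "hermitian_mat n D" using assms by (simp add: psd_mat_def)
  obtain V l where V: "unitary_mat n V" "D = V * real_diag n l * V\<^sup>\<dagger>" using spectral_theorem[OF h] by blast
  \<comment> \<open>any upper bound of the spectrum will do: the interval criterion needs both ends\<close>
  define K where "K = (\<Sum>i<n. \<bar>l i\<bar>)"
  have "\<bar>l i\<bar> \<le> K" if "i < n" for i unfolding K_def using that by (intro member_le_sum) auto
  then have "hermitian_on n {-K..K} D" unfolding hermitian_on_dec[OF V] by force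
  then have "hermitian_on n {0..K} D" using assms unfolding psd_mat_iff hermitian_on_interval_iff by simp
  then show thesis using that[OF V] unfolding hermitian_on_dec[OF V] by simp
qed

text \<open>
  The spectral decomposition of \<open>B - A\<close> gives a chain from \<open>A\<close> to \<open>B\<close> with rank-one steps. All its
  members lie between \<open>A\<close> and \<open>B\<close>, hence have their spectrum in \<open>(0,\<alpha>)\<close>. The chain is run for
  \<open>f(t)/t\<close>, and inverted at the end.
\<close>

lemma rank_one_imp_monotone:
  assumes ineq: "rank_one_contraction_ineq n {0..<\<alpha>} f" and "\<alpha> > 0" and f: "\<And>t. t \<in> {0..<\<alpha>} \<Longrightarrow> f t > 0"
  shows "matrix_monotone n {0<..<\<alpha>} (\<lambda>t. t / f t)"
  unfolding matrix_monotone_def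
proof (intro allI impI)
  fix A B assume A: "hermitian_on n {0<..<\<alpha>} A" and B: "hermitian_on n {0<..<\<alpha>} B" and le: "loewner_le n A B"
  note hA = hermitian_on_hermitian[OF A] and hB = hermitian_on_hermitian[OF B]
  note [simp] = hermitian_mat_dim[OF hA] hermitian_mat_dim[OF hB]
  obtain V l where V: "unitary_mat n V" "B - A = V * real_diag n l * V\<^sup>\<dagger>" and l: "\<And>i. i < n \<Longrightarrow> l i \<ge> 0"
    using le psd_spectral[of n "B - A"] unfolding loewner_le_def by metis
  note [simp] = unitary_mat_dim(1,2)[OF V(1)]
  \<comment> \<open>partial sums of the rank-one decomposition of \<open>B - A\<close>\<close>
  define P where "P = (\<lambda>k. V * real_diag n (\<lambda>i. if i < k then l i else 0) * V\<^sup>\<dagger>)"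
  have [simp]: "dim_row (P k) = n" "dim_col (P k) = n" "(P k)\<^sup>\<dagger> = P k" for k by (auto simp: P_def mat_expand)
  obtain e r where er: "0 < e" "r < \<alpha>" "hermitian_on n {e..r} A" using hermitian_on_open[OF A \<open>\<alpha> > 0\<close>] .
  obtain e' r' where er': "0 < e'" "r' < \<alpha>" "hermitian_on n {e'..r'} B" using hermitian_on_open[OF B \<open>\<alpha> > 0\<close>] .
  have AP: "hermitian_on n {0<..<\<alpha>} (A + P k)" for k
  proof -
    have "hermitian_on n {e..r'} (A + P k)"
      unfolding hermitian_on_interval_iff
    proof (intro conjI allI impI)
      show "hermitian_mat n (A + P k)" by (intro hermitian_matI) auto
      fix x :: "complex mat" assume x: "dim_row x = n" "dim_col x = 1"
      have eq: "qf (A + P k) x = qf A x + qf (P k) x" using x by (intro qf_add) auto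
      have "0 \<le> qf (P k) x" unfolding P_def qf_dec[OF V(1) x] using l by (intro sum_nonneg) auto
      then show "e * qf (1\<^sub>m n) x \<le> qf (A + P k) x" using er(3) x unfolding eq hermitian_on_interval_iff by force
      have "qf (P k) x \<le> qf (B - A) x" unfolding P_def V(2) qf_dec[OF V(1) x] using l
        by (intro sum_mono mult_right_mono) auto
      also have "\<dots> = qf B x - qf A x" using x by (intro qf_minus) auto
      finally show "qf (A + P k) x \<le> r' * qf (1\<^sub>m n) x" using er'(3) x unfolding eq hermitian_on_interval_iff by force
    qed
    then show ?thesis by (rule hermitian_on_mono) (use er er' in auto)
  qed
  have step: "A + P k = (A + P (Suc k)) - x * x\<^sup>\<dagger>"
    if k: "k < n" and x: "x = complex_of_real (sqrt (l k)) \<cdot>\<^sub>m (V * embed n 1 k)" for k x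
  proof -
    have "real_diag n (\<lambda>i. if i < Suc k then l i else 0) =
      real_diag n (\<lambda>i. if i < k then l i else 0) + complex_of_real (l k) \<cdot>\<^sub>m (embed n 1 k * (embed n 1 k)\<^sup>\<dagger>)"
      by (rule eq_matI) (auto simp: mat_diag_def index_embed_mult index_embed less_Suc_eq simp del: index_mult_mat(1))
    then have "P (Suc k) = P k + complex_of_real (l k) \<cdot>\<^sub>m (V * embed n 1 k * (V * embed n 1 k)\<^sup>\<dagger>)"
      by (simp add: P_def mat_expand)
    moreover have "x * x\<^sup>\<dagger> = complex_of_real (l k) \<cdot>\<^sub>m (V * embed n 1 k * (V * embed n 1 k)\<^sup>\<dagger>)"
      using l[OF k] by (simp add: x mat_expand flip: of_real_mult)
    ultimately show ?thesis by (auto simp del: index_mult_mat(1) intro!: eq_matI)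
  qed
  have chain: "loewner_le n (mat_fun (\<lambda>t. f t / t) (A + P k)) (mat_fun (\<lambda>t. f t / t) (A + P 0))" if "k \<le> n" for k
    using that
  proof (induction k)
    case 0
    show ?case by (intro loewner_le_refl hermitian_mat_fun hermitian_on_hermitian[OF AP])
  next
    case (Suc k)
    have "loewner_le n (mat_fun (\<lambda>t. f t / t) (A + P (Suc k))) (mat_fun (\<lambda>t. f t / t) (A + P k))"
      by (rule rank_one_increment_antimono[OF ineq \<open>\<alpha> > 0\<close> AP AP _ _ step[OF _ refl]]) (use Suc.prems in auto)
    also have "loewner_le n \<dots> (mat_fun (\<lambda>t. f t / t) (A + P 0))" using Suc by simp
    finally show ?case .
  qed
  have "real_diag n (\<lambda>i. if i < (0::nat) then l i else 0) = 0\<^sub>m n n" by (rule eq_matI) (auto simp: mat_diag_def)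
  then have "P 0 = 0\<^sub>m n n" by (simp add: P_def mat_expand)
  then have A0: "A + P 0 = A" by (auto intro!: eq_matI)
  have "real_diag n (\<lambda>i. if i < n then l i else 0) = real_diag n l" by (rule eq_matI) (auto simp: mat_diag_def)
  then have "P n = B - A" by (simp add: P_def V(2))
  then have An: "A + P n = B" by (auto intro!: eq_matI)
  have "loewner_le n (mat_fun (\<lambda>t. 1 / (f t / t)) A) (mat_fun (\<lambda>t. 1 / (f t / t)) B)"
    by (rule loewner_inverse_antimono[OF A B]) (use f chain[of n] A0 An in auto)
  then show "loewner_le n (mat_fun (\<lambda>t. t / f t) A) (mat_fun (\<lambda>t. t / f t) B)" by simp
qed

section \<open>From monotonicity to contractions and concavity\<close>

lemma shift_spectrum:
  assumes A: "hermitian_on n {a..b} A" and E: "hermitian_on n {c..d} E" and "\<epsilon> \<ge> 0"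
  shows "hermitian_on n {a + \<epsilon> * c..b + \<epsilon> * d} (A + complex_of_real \<epsilon> \<cdot>\<^sub>m E)"
proof -
  note [simp] = hermitian_mat_dim[OF hermitian_on_hermitian[OF A]] hermitian_mat_dim[OF hermitian_on_hermitian[OF E]]
  show ?thesis unfolding hermitian_on_interval_iff
  proof (intro conjI allI impI)
    show "hermitian_mat n (A + complex_of_real \<epsilon> \<cdot>\<^sub>m E)" by (intro hermitian_matI) auto
    fix x :: "complex mat" assume x: "dim_row x = n" "dim_col x = 1"
    have eq: "qf (A + complex_of_real \<epsilon> \<cdot>\<^sub>m E) x = qf A x + \<epsilon> * qf E x"
      using x by (simp add: qf_add[of _ n] qf_smult[of _ n])
    have A1: "a * qf (1\<^sub>m n) x \<le> qf A x" "qf A x \<le> b * qf (1\<^sub>m n) x"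
      using A x unfolding hermitian_on_interval_iff by auto
    have E1: "\<epsilon> * (c * qf (1\<^sub>m n) x) \<le> \<epsilon> * qf E x" "\<epsilon> * qf E x \<le> \<epsilon> * (d * qf (1\<^sub>m n) x)"
      using E x \<open>\<epsilon> \<ge> 0\<close> unfolding hermitian_on_interval_iff by (auto intro!: mult_left_mono)
    show "(a + \<epsilon> * c) * qf (1\<^sub>m n) x \<le> qf (A + complex_of_real \<epsilon> \<cdot>\<^sub>m E) x"
      "qf (A + complex_of_real \<epsilon> \<cdot>\<^sub>m E) x \<le> (b + \<epsilon> * d) * qf (1\<^sub>m n) x"
      unfolding eq using A1 E1 by (auto simp: distrib_right mult.assoc)
  qed
qed

lemma hermitian_on_one: "hermitian_on n {1..1} (1\<^sub>m n)"
  unfolding hermitian_on_interval_iff by (auto intro: hermitian_matI)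

text \<open>
  Continuity of the functional calculus on \<open>[0,\<alpha>)\<close>: for small \<open>\<epsilon>\<close> the perturbed spectra stay in
  \<open>[0,(r + \<alpha>)/2]\<close>.
\<close>

lemma shift_tendsto:
  assumes A: "hermitian_on n {0..r} A" and E: "hermitian_on n {0..1} E" and "0 \<le> r" "r < \<alpha>"
    and f: "continuous_on {0..<\<alpha>} f" and x: "dim_row x = n" "dim_col x = 1"
  shows "((\<lambda>\<epsilon>. qf (mat_fun f (A + complex_of_real \<epsilon> \<cdot>\<^sub>m E)) x) \<longlongrightarrow> qf (mat_fun f A) x) (at_right 0)"
proof (rule mat_fun_tendsto[of n 0 "(r + \<alpha>) / 2" A E "(\<alpha> - r) / 2"])
  show "hermitian_on n {0..(r + \<alpha>) / 2} A" by (rule hermitian_on_mono[OF A]) (use assms in auto)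
  show "hermitian_on n {0..(r + \<alpha>) / 2} (A + complex_of_real \<epsilon> \<cdot>\<^sub>m E)" if "0 < \<epsilon>" "\<epsilon> \<le> (\<alpha> - r) / 2" for \<epsilon>
    by (rule hermitian_on_mono[OF shift_spectrum[OF A E]]) (use that in \<open>auto simp: field_simps\<close>)
  show "continuous_on {0..(r + \<alpha>) / 2} f" by (rule continuous_on_subset[OF f]) (use assms in auto)
qed (use assms hermitian_on_hermitian[OF E] in auto)

text \<open>
  Shift both matrices by \<open>\<epsilon>\<close> into \<open>(0,\<alpha>)\<close> and let \<open>\<epsilon> \<rightarrow> 0\<close>. The extension admits singular matrices
  \<open>A\<^bsup>1/2\<^esup> C C\<^sup>\<dagger> A\<^bsup>1/2\<^esup>\<close>, that is, contractions \<open>C\<close> that are not invertible.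
\<close>

lemma monotone_extends_to_zero:
  assumes mono: "matrix_monotone n {0<..<\<alpha>} g" and g: "continuous_on {0..<\<alpha>} g" and "\<alpha> > 0"
  shows "matrix_monotone n {0..<\<alpha>} g"
  unfolding matrix_monotone_def
proof (intro allI impI)
  fix A B assume A: "hermitian_on n {0..<\<alpha>} A" and B: "hermitian_on n {0..<\<alpha>} B" and le: "loewner_le n A B"
  note hA = hermitian_on_hermitian[OF A] and hB = hermitian_on_hermitian[OF B]
  note [simp] = hermitian_mat_dim[OF hA] hermitian_mat_dim[OF hB]
  obtain r1 where r1: "0 \<le> r1" "r1 < \<alpha>" "hermitian_on n {0..r1} A" using hermitian_on_half_open[OF A \<open>\<alpha> > 0\<close>] .
  obtain r2 where r2: "0 \<le> r2" "r2 < \<alpha>" "hermitian_on n {0..r2} B" using hermitian_on_half_open[OF B \<open>\<alpha> > 0\<close>] .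
  have one: "hermitian_on n {0..1} (1\<^sub>m n)" by (rule hermitian_on_mono[OF hermitian_on_one]) auto
  have pos: "hermitian_on n {0<..<\<alpha>} (X + complex_of_real \<epsilon> \<cdot>\<^sub>m 1\<^sub>m n)"
    if "hermitian_on n {0..r} X" "0 < \<epsilon>" "\<epsilon> < \<alpha> - r" for X \<epsilon> r
    by (rule hermitian_on_mono[OF shift_spectrum[OF that(1) hermitian_on_one]]) (use that in auto)
  show "loewner_le n (mat_fun g A) (mat_fun g B)"
  proof (intro loewner_leI hermitian_mat_fun hA hB)
    fix x :: "complex mat" assume x: "dim_row x = n" "dim_col x = 1"
    have "eventually (\<lambda>\<epsilon>. \<epsilon> \<in> {0<..<min (\<alpha> - r1) (\<alpha> - r2)}) (at_right 0)"
      by (rule eventually_at_right_real) (use r1 r2 in auto)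
    then have ev: "eventually (\<lambda>\<epsilon>. qf (mat_fun g (A + complex_of_real \<epsilon> \<cdot>\<^sub>m 1\<^sub>m n)) x
        \<le> qf (mat_fun g (B + complex_of_real \<epsilon> \<cdot>\<^sub>m 1\<^sub>m n)) x) (at_right 0)"
    proof eventually_elim
      case (elim \<epsilon>)
      have A\<epsilon>: "hermitian_on n {0<..<\<alpha>} (A + complex_of_real \<epsilon> \<cdot>\<^sub>m 1\<^sub>m n)" by (rule pos[OF r1(3)]) (use elim in auto)
      have B\<epsilon>: "hermitian_on n {0<..<\<alpha>} (B + complex_of_real \<epsilon> \<cdot>\<^sub>m 1\<^sub>m n)" by (rule pos[OF r2(3)]) (use elim in auto)
      have "loewner_le n (A + complex_of_real \<epsilon> \<cdot>\<^sub>m 1\<^sub>m n) (B + complex_of_real \<epsilon> \<cdot>\<^sub>m 1\<^sub>m n)"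
        using le hermitian_on_hermitian[OF A\<epsilon>] hermitian_on_hermitian[OF B\<epsilon>]
        by (auto simp: loewner_le_iff qf_add[of _ n])
      then have "loewner_le n (mat_fun g (A + complex_of_real \<epsilon> \<cdot>\<^sub>m 1\<^sub>m n)) (mat_fun g (B + complex_of_real \<epsilon> \<cdot>\<^sub>m 1\<^sub>m n))"
        using mono A\<epsilon> B\<epsilon> unfolding matrix_monotone_def by blast
      then show ?case using x unfolding loewner_le_iff by blast
    qed
    show "qf (mat_fun g A) x \<le> qf (mat_fun g B) x"
      by (rule tendsto_le[OF _ shift_tendsto[OF r2(3) one r2(1,2) g x] shift_tendsto[OF r1(3) one r1(1,2) g x] ev]) simp
  qed
qed

text \<open>
  With \<open>Z = A\<^bsup>1/2\<^esup> C\<close>, \<open>D = Z Z\<^sup>\<dagger> \<le> A\<close> and \<open>K = Z\<^sup>\<dagger> Z = C\<^sup>\<dagger> A C\<close>, the intertwiner \<open>Z\<close> gives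
  \<open>g(D) = Z f(K)\<^sup>-\<^sup>1 Z\<^sup>\<dagger>\<close>, so \<open>g(D) \<le> g(A)\<close> amounts to \<open>C f(K)\<^sup>-\<^sup>1 C\<^sup>\<dagger> \<le> f(A)\<^sup>-\<^sup>1\<close>. This says \<open>X X\<^sup>\<dagger> \<le> 1\<close>
  for \<open>X = f(A)\<^bsup>1/2\<^esup> C f(K)\<^bsup>-1/2\<^esup>\<close>, and \<open>X\<^sup>\<dagger> X \<le> 1\<close> is the claim. Only the cancellation of \<open>A\<^bsup>1/2\<^esup>\<close>
  needs \<open>A > 0\<close>.
\<close>

lemma monotone_imp_contraction_ineq_pos:
  assumes mono: "matrix_monotone n {0..<\<alpha>} (\<lambda>t. t / f t)" and f: "\<And>t. t \<in> {0..<\<alpha>} \<Longrightarrow> f t > 0" and "\<alpha> > 0"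
    and A: "hermitian_on n {0<..<\<alpha>} A" and C: "dim_row C = n" "dim_col C = n" "loewner_le n (C\<^sup>\<dagger> * C) (1\<^sub>m n)"
  shows "loewner_le n (C\<^sup>\<dagger> * mat_fun f A * C) (mat_fun f (C\<^sup>\<dagger> * A * C))"
proof -
  note hA = hermitian_on_hermitian[OF A]
  have A0: "hermitian_on n {0..<\<alpha>} A" using A by (rule hermitian_on_mono) auto
  obtain r where r: "0 \<le> r" "r < \<alpha>" "hermitian_on n {0..r} A" using hermitian_on_half_open[OF A0 \<open>\<alpha> > 0\<close>] .
  define K where "K = C\<^sup>\<dagger> * A * C"
  have K: "hermitian_on n {0..<\<alpha>} K" unfolding K_def
    by (rule hermitian_on_mono[OF hermitian_on_contraction_congruence[OF r(3,1) C]]) (use r in auto)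
  note hK = hermitian_on_hermitian[OF K]
  define S where "S = mat_fun sqrt A"
  define S' where "S' = mat_fun (\<lambda>t. 1 / sqrt t) A"
  have SS: "S * S = A" "S * S' = 1\<^sub>m n" "S' * S = 1\<^sub>m n"
    using mat_fun_sqrt_inverse[OF A] by (auto simp: S_def S'_def)
  note [simp] = C(1,2) hermitian_mat_dim[OF hA] dim_mat_fun[OF hA] hermitian_mat_dim[OF hK] dim_mat_fun[OF hK]
  have [simp]: "dim_row S = n" "dim_col S = n" "S\<^sup>\<dagger> = S" "dim_row S' = n" "dim_col S' = n" "S'\<^sup>\<dagger> = S'"
    by (auto simp: S_def S'_def)
  define Z where "Z = S * C"
  have [simp]: "dim_row Z = n" "dim_col Z = n" by (auto simp: Z_def)
  define D where "D = Z * Z\<^sup>\<dagger>"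
  have [simp]: "dim_row D = n" "dim_col D = n" "D\<^sup>\<dagger> = D" by (auto simp: D_def)
  have hD: "hermitian_mat n D" by (intro hermitian_matI) auto
  have "loewner_le n (C * C\<^sup>\<dagger>) (1\<^sub>m n)" by (rule loewner_gram_swap[OF C])
  then have "loewner_le n (S\<^sup>\<dagger> * (C * C\<^sup>\<dagger>) * S) (S\<^sup>\<dagger> * 1\<^sub>m n * S)" by (rule loewner_le_congruence) auto
  then have DA: "loewner_le n D A" by (simp add: D_def Z_def mat_expand SS)
  have "hermitian_on n {0..r} D"
    unfolding hermitian_on_interval_iff
  proof (intro conjI allI impI hD)
    fix x :: "complex mat" assume x: "dim_row x = n" "dim_col x = 1"
    show "0 * qf (1\<^sub>m n) x \<le> qf D x" using qf_gram_nonneg[of Z n x] x by (simp add: D_def)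
    have "qf D x \<le> qf A x" using DA x unfolding loewner_le_iff by blast
    also have "\<dots> \<le> r * qf (1\<^sub>m n) x" using r(3) x unfolding hermitian_on_interval_iff by blast
    finally show "qf D x \<le> r * qf (1\<^sub>m n) x" .
  qed
  then have D: "hermitian_on n {0..<\<alpha>} D" by (rule hermitian_on_mono) (use r in auto)
  have gle: "loewner_le n (mat_fun (\<lambda>t. t / f t) D) (mat_fun (\<lambda>t. t / f t) A)"
    using mono D A0 DA unfolding matrix_monotone_def by blast
  define N where "N = mat_fun (\<lambda>t. 1 / f t) K"
  define M where "M = mat_fun (\<lambda>t. 1 / sqrt (f t)) K"
  define M' where "M' = mat_fun (\<lambda>t. sqrt (f t)) K"
  define Q where "Q = mat_fun (\<lambda>t. sqrt (f t)) A"
  have [simp]: "dim_row N = n" "dim_col N = n" "N\<^sup>\<dagger> = N" "dim_row M = n" "dim_col M = n" "M\<^sup>\<dagger> = M"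
    "dim_row M' = n" "dim_col M' = n" "M'\<^sup>\<dagger> = M'" "dim_row Q = n" "dim_col Q = n" "Q\<^sup>\<dagger> = Q"
    by (auto simp: N_def M_def M'_def Q_def)
  have MM: "M * M = N" unfolding M_def N_def mat_fun_mult[OF hK]
    by (intro mat_fun_cong[OF K]; use f in force)
  have M'M': "M' * M' = mat_fun f K" unfolding M'_def mat_fun_mult[OF hK]
    by (intro mat_fun_cong[OF K]; use f in force)
  have one: "mat_fun (\<lambda>_. 1) X = 1\<^sub>m n" if "hermitian_mat n X" for X
    by (auto simp: mat_fun_const[OF that] intro!: eq_matI)
  have MM': "M * M' = 1\<^sub>m n" "M' * M = 1\<^sub>m n"
    unfolding M_def M'_def mat_fun_mult[OF hK] one[OF hK, symmetric] by (intro mat_fun_cong[OF K]; use f in force)+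
  have QQ: "Q * Q = mat_fun f A" unfolding Q_def mat_fun_mult[OF hA]
    by (intro mat_fun_cong[OF A0]; use f in force)
  have "Q * mat_fun (\<lambda>t. 1 / f t) A * Q = mat_fun (\<lambda>_. 1) A"
    unfolding Q_def mat_fun_mult[OF hA] by (intro mat_fun_cong[OF A0]; use f in force)
  then have Q1: "Q * (mat_fun (\<lambda>t. 1 / f t) A * Q) = 1\<^sub>m n" by (simp add: one[OF hA] mat_expand)
  have gD: "mat_fun (\<lambda>t. t / f t) D = Z * N * Z\<^sup>\<dagger>"
  proof -
    note [simp] = dim_mat_fun[OF hD]
    have DZ: "mat_fun (\<lambda>t. 1 / f t) D * Z = Z * N"
      unfolding N_def by (intro mat_fun_intertwine[OF hD hK])
        (simp_all add: D_def K_def Z_def mat_expand flip: SS(1))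
    have "mat_fun (\<lambda>t. 1 / f t) D * D = (mat_fun (\<lambda>t. 1 / f t) D * Z) * Z\<^sup>\<dagger>"
      by (subst (2) D_def) (simp add: mult_assoc_dim)
    then show ?thesis unfolding DZ using mat_fun_mult[OF hD, of "\<lambda>t. 1 / f t" "\<lambda>t. t"] by (simp add: mat_fun_id[OF hD])
  qed
  have gA: "mat_fun (\<lambda>t. t / f t) A = S * mat_fun (\<lambda>t. 1 / f t) A * S"
    unfolding S_def mat_fun_mult[OF hA] by (intro mat_fun_cong[OF A]) (auto simp: field_simps)
  have "loewner_le n (S'\<^sup>\<dagger> * mat_fun (\<lambda>t. t / f t) D * S') (S'\<^sup>\<dagger> * mat_fun (\<lambda>t. t / f t) A * S')"
    by (rule loewner_le_congruence[OF gle]) auto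
  then have "loewner_le n (C * N * C\<^sup>\<dagger>) (mat_fun (\<lambda>t. 1 / f t) A)"
    unfolding gD gA by (simp add: Z_def mat_expand SS mult_cancel_dim[OF SS(2)] mult_cancel_dim[OF SS(3)])
  then have "loewner_le n (Q\<^sup>\<dagger> * (C * N * C\<^sup>\<dagger>) * Q) (Q\<^sup>\<dagger> * mat_fun (\<lambda>t. 1 / f t) A * Q)"
    by (rule loewner_le_congruence) auto
  then have "loewner_le n (((Q * C * M)\<^sup>\<dagger>)\<^sup>\<dagger> * (Q * C * M)\<^sup>\<dagger>) (1\<^sub>m n)"
    by (simp add: mat_expand Q1 flip: MM)
  then have "loewner_le n ((Q * C * M)\<^sup>\<dagger> * ((Q * C * M)\<^sup>\<dagger>)\<^sup>\<dagger>) (1\<^sub>m n)" by (intro loewner_gram_swap) auto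
  then have "loewner_le n (M * C\<^sup>\<dagger> * mat_fun f A * C * M) (1\<^sub>m n)" by (simp add: mat_expand flip: QQ)
  then have "loewner_le n (M'\<^sup>\<dagger> * (M * C\<^sup>\<dagger> * mat_fun f A * C * M) * M') (M'\<^sup>\<dagger> * 1\<^sub>m n * M')"
    by (rule loewner_le_congruence) auto
  then show ?thesis
    unfolding K_def[symmetric] by (simp add: mat_expand M'M' MM' mult_cancel_dim[OF MM'(2)])
qed

lemma monotone_imp_contraction_ineq:
  assumes mono: "matrix_monotone n {0<..<\<alpha>} (\<lambda>t. t / f t)" and f: "continuous_on {0..<\<alpha>} f"
    and pos: "\<And>t. t \<in> {0..<\<alpha>} \<Longrightarrow> f t > 0" and "\<alpha> > 0"
  shows "matrix_contraction_ineq n {0..<\<alpha>} f"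
  unfolding matrix_contraction_ineq_def
proof (intro allI impI)
  fix A C assume A: "hermitian_on n {0..<\<alpha>} A" and "contraction_mat n C"
  then have [simp]: "dim_row C = n" "dim_col C = n" by (auto simp: contraction_mat_iff)
  have CC: "loewner_le n (C\<^sup>\<dagger> * C) (1\<^sub>m n)"
    using \<open>contraction_mat n C\<close> by (auto simp: contraction_mat_iff loewner_le_iff intro!: hermitian_matI)
  note hA = hermitian_on_hermitian[OF A]
  note [simp] = hermitian_mat_dim[OF hA] dim_mat_fun[OF hA]
  have g: "continuous_on {0..<\<alpha>} (\<lambda>t. t / f t)"
    by (intro continuous_intros f) (use pos in force)
  have mono0: "matrix_monotone n {0..<\<alpha>} (\<lambda>t. t / f t)" by (rule monotone_extends_to_zero[OF mono g \<open>\<alpha> > 0\<close>])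
  obtain r where r: "0 \<le> r" "r < \<alpha>" "hermitian_on n {0..r} A" using hermitian_on_half_open[OF A \<open>\<alpha> > 0\<close>] .
  have one: "hermitian_on n {0..1} (1\<^sub>m n)" by (rule hermitian_on_mono[OF hermitian_on_one]) auto
  have K: "hermitian_on n {0..r} (C\<^sup>\<dagger> * A * C)" by (rule hermitian_on_contraction_congruence[OF r(3,1) _ _ CC]) auto
  note hK = hermitian_on_hermitian[OF K]
  have E: "hermitian_on n {0..1} (C\<^sup>\<dagger> * C)"
    using hermitian_on_contraction_congruence[OF one _ _ _ CC] by (simp add: mult_one_dim)
  show "loewner_le n (C\<^sup>\<dagger> * mat_fun f A * C) (mat_fun f (C\<^sup>\<dagger> * A * C))"
  proof (intro loewner_leI hermitian_mat_fun hK hermitian_congruence[OF hermitian_mat_fun[OF hA]])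
    fix x :: "complex mat" assume x: "dim_row x = n" "dim_col x = 1"
    have "eventually (\<lambda>\<epsilon>. \<epsilon> \<in> {0<..<\<alpha> - r}) (at_right 0)" by (rule eventually_at_right_real) (use r in auto)
    then have ev: "eventually (\<lambda>\<epsilon>. qf (mat_fun f (A + complex_of_real \<epsilon> \<cdot>\<^sub>m 1\<^sub>m n)) (C * x)
        \<le> qf (mat_fun f (C\<^sup>\<dagger> * A * C + complex_of_real \<epsilon> \<cdot>\<^sub>m (C\<^sup>\<dagger> * C))) x) (at_right 0)"
    proof eventually_elim
      case (elim \<epsilon>)
      have A\<epsilon>: "hermitian_on n {0<..<\<alpha>} (A + complex_of_real \<epsilon> \<cdot>\<^sub>m 1\<^sub>m n)"
        by (rule hermitian_on_mono[OF shift_spectrum[OF r(3) hermitian_on_one]]) (use elim in auto)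
      note [simp] = dim_mat_fun[OF hermitian_on_hermitian[OF A\<epsilon>]]
      have "loewner_le n (C\<^sup>\<dagger> * mat_fun f (A + complex_of_real \<epsilon> \<cdot>\<^sub>m 1\<^sub>m n) * C) (mat_fun f (C\<^sup>\<dagger> * (A + complex_of_real \<epsilon> \<cdot>\<^sub>m 1\<^sub>m n) * C))"
        by (rule monotone_imp_contraction_ineq_pos[OF mono0 pos \<open>\<alpha> > 0\<close> A\<epsilon> _ _ CC]) auto
      moreover have "C\<^sup>\<dagger> * (A + complex_of_real \<epsilon> \<cdot>\<^sub>m 1\<^sub>m n) * C = C\<^sup>\<dagger> * A * C + complex_of_real \<epsilon> \<cdot>\<^sub>m (C\<^sup>\<dagger> * C)"
        by (simp add: mat_expand)
      ultimately show ?case using x qf_congruence[of "mat_fun f (A + complex_of_real \<epsilon> \<cdot>\<^sub>m 1\<^sub>m n)" n C n x]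
        unfolding loewner_le_iff by auto
    qed
    have Cx: "dim_row (C * x) = n" "dim_col (C * x) = 1" using x by auto
    have "qf (mat_fun f A) (C * x) \<le> qf (mat_fun f (C\<^sup>\<dagger> * A * C)) x"
      by (rule tendsto_le[OF _ shift_tendsto[OF K E r(1,2) f x] shift_tendsto[OF r(3) one r(1,2) f Cx] ev]) simp
    then show "qf (C\<^sup>\<dagger> * mat_fun f A * C) x \<le> qf (mat_fun f (C\<^sup>\<dagger> * A * C)) x"
      using x by (simp add: qf_congruence[of _ n _ n])
  qed auto
qed

text \<open>
  The contraction is \<open>C = K J\<^sup>\<dagger>\<close> with the isometry \<open>K = \<surd>l J + \<surd>(1 - l) L\<close>, since
  \<open>K\<^sup>\<dagger> (X \<oplus> Y) K = l X + (1 - l) Y\<close> for all \<open>X\<close> and \<open>Y\<close>. If \<open>2 m < n\<close>, the remaining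
  coordinates carry the eigenvalue \<open>0\<close>.
\<close>

lemma contraction_ineq_imp_concave:
  assumes ineq: "matrix_contraction_ineq n {0..<\<alpha>} f" and "\<alpha> > 0" and mn: "2 * m \<le> n"
  shows "matrix_concave m {0..<\<alpha>} f"
  unfolding matrix_concave_def
proof (intro allI ballI impI)
  fix A B and l :: real
  assume l: "l \<in> {0..1}" and A: "hermitian_on m {0..<\<alpha>} A" and B: "hermitian_on m {0..<\<alpha>} B"
  note hA = hermitian_on_hermitian[OF A] and hB = hermitian_on_hermitian[OF B]
  note [simp] = hermitian_mat_dim[OF hA] dim_mat_fun[OF hA] hermitian_mat_dim[OF hB] dim_mat_fun[OF hB]
  obtain r1 where r1: "0 \<le> r1" "r1 < \<alpha>" "hermitian_on m {0..r1} A" using hermitian_on_half_open[OF A \<open>\<alpha> > 0\<close>] .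
  obtain r2 where r2: "0 \<le> r2" "r2 < \<alpha>" "hermitian_on m {0..r2} B" using hermitian_on_half_open[OF B \<open>\<alpha> > 0\<close>] .
  define J where "J = embed n m 0"
  define L where "L = embed n m m"
  have [simp]: "dim_row J = n" "dim_col J = m" "dim_row L = n" "dim_col L = m" by (auto simp: J_def L_def)
  have JJ: "J\<^sup>\<dagger> * J = 1\<^sub>m m" and LL: "L\<^sup>\<dagger> * L = 1\<^sub>m m" and JL: "J\<^sup>\<dagger> * L = 0\<^sub>m m m" and LJ: "L\<^sup>\<dagger> * J = 0\<^sub>m m m"
    unfolding J_def L_def using mn by (auto intro!: embed_isometry embed_orthogonal)
  note canc = JJ LL JL LJ mult_cancel_dim[OF JJ] mult_cancel_dim[OF LL] zero_cancel_dim[OF JL] zero_cancel_dim[OF LJ]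
  have zero: "X + 0\<^sub>m n m = X" "0\<^sub>m n m + X = X" if "dim_row X = n" "dim_col X = m" for X :: "complex mat"
    using that by (auto intro!: eq_matI)
  define At where "At = J * A * J\<^sup>\<dagger> + L * B * L\<^sup>\<dagger>"
  have [simp]: "dim_row At = n" "dim_col At = n" "At\<^sup>\<dagger> = At" by (auto simp: At_def mat_expand)
  have hAt: "hermitian_mat n At" by (intro hermitian_matI) auto
  \<comment> \<open>\<open>J J\<^sup>\<dagger> + L L\<^sup>\<dagger>\<close> is a projection, so its complement is positive\<close>
  have proj: "qf (1\<^sub>m m) (J\<^sup>\<dagger> * x) + qf (1\<^sub>m m) (L\<^sup>\<dagger> * x) \<le> qf (1\<^sub>m n) x" if x: "dim_row x = n" "dim_col x = 1" for x
  proof -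
    define Q where "Q = 1\<^sub>m n - (J * J\<^sup>\<dagger> + L * L\<^sup>\<dagger>)"
    have [simp]: "dim_row Q = n" "dim_col Q = n" "Q\<^sup>\<dagger> = Q" by (auto simp: Q_def)
    have "Q * Q\<^sup>\<dagger> = Q"
      unfolding Q_def by (simp add: mat_expand canc) (auto simp del: index_mult_mat(1) intro!: eq_matI)
    then have "0 \<le> qf Q x" using qf_gram_nonneg[of Q n x] x by simp
    also have "qf Q x = qf (1\<^sub>m n) x - (qf (J * J\<^sup>\<dagger>) x + qf (L * L\<^sup>\<dagger>) x)"
      unfolding Q_def using x by (simp add: qf_add[of _ n] qf_minus[of _ n])
    finally show ?thesis using x qf_gram[of "J\<^sup>\<dagger>" n x m] qf_gram[of "L\<^sup>\<dagger>" n x m] by simp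
  qed
  define r where "r = max r1 r2"
  have "hermitian_on n {0..r} At" unfolding hermitian_on_interval_iff
  proof (intro conjI allI impI hAt)
    fix x :: "complex mat" assume x: "dim_row x = n" "dim_col x = 1"
    have eq: "qf At x = qf A (J\<^sup>\<dagger> * x) + qf B (L\<^sup>\<dagger> * x)"
      unfolding At_def using x qf_congruence[of A m "J\<^sup>\<dagger>" n x] qf_congruence[of B m "L\<^sup>\<dagger>" n x] by (simp add: qf_add[of _ n])
    have Ar: "hermitian_on m {0..r} A" "hermitian_on m {0..r} B"
      by (rule hermitian_on_mono[OF r1(3)], simp add: r_def, rule hermitian_on_mono[OF r2(3)], simp add: r_def)
    have A1: "0 \<le> qf A (J\<^sup>\<dagger> * x)" "qf A (J\<^sup>\<dagger> * x) \<le> r * qf (1\<^sub>m m) (J\<^sup>\<dagger> * x)"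
      using Ar(1) x unfolding hermitian_on_interval_iff by auto
    have B1: "0 \<le> qf B (L\<^sup>\<dagger> * x)" "qf B (L\<^sup>\<dagger> * x) \<le> r * qf (1\<^sub>m m) (L\<^sup>\<dagger> * x)"
      using Ar(2) x unfolding hermitian_on_interval_iff by auto
    show "0 * qf (1\<^sub>m n) x \<le> qf At x" unfolding eq using A1 B1 by simp
    have "r * (qf (1\<^sub>m m) (J\<^sup>\<dagger> * x) + qf (1\<^sub>m m) (L\<^sup>\<dagger> * x)) \<le> r * qf (1\<^sub>m n) x"
      using r1(1) by (intro mult_left_mono proj x) (auto simp: r_def)
    then show "qf At x \<le> r * qf (1\<^sub>m n) x" unfolding eq using A1 B1 by (simp add: distrib_left)
  qed
  then have At: "hermitian_on n {0..<\<alpha>} At" by (rule hermitian_on_mono) (use r1 r2 in \<open>auto simp: r_def\<close>)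
  note [simp] = dim_mat_fun[OF hAt]
  have fJ: "mat_fun f At * J = J * mat_fun f A"
    by (intro mat_fun_intertwine[OF hAt hA]) (simp_all add: At_def mat_expand canc zero)
  have fL: "mat_fun f At * L = L * mat_fun f B"
    by (intro mat_fun_intertwine[OF hAt hB]) (simp_all add: At_def mat_expand canc zero)
  define a where "a = complex_of_real (sqrt l)"
  define b where "b = complex_of_real (sqrt (1 - l))"
  have ab: "cnj a = a" "cnj b = b" "a * a = complex_of_real l" "b * b = complex_of_real (1 - l)"
    using l by (auto simp: a_def b_def simp flip: of_real_mult)
  define K where "K = a \<cdot>\<^sub>m J + b \<cdot>\<^sub>m L"
  have [simp]: "dim_row K = n" "dim_col K = m" by (auto simp: K_def)
  have zero': "X + 0\<^sub>m m m = X" "0\<^sub>m m m + X = X" if "dim_row X = m" "dim_col X = m" for X :: "complex mat"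
    using that by (auto intro!: eq_matI)
  have s0: "c \<cdot>\<^sub>m 0\<^sub>m m m = 0\<^sub>m m m" for c :: complex by (rule eq_matI) auto
  \<comment> \<open>the cross terms vanish as \<open>J\<close> and \<open>L\<close> have orthogonal ranges\<close>
  have compress: "K\<^sup>\<dagger> * (a \<cdot>\<^sub>m (J * X) + b \<cdot>\<^sub>m (L * Y)) = complex_of_real l \<cdot>\<^sub>m X + complex_of_real (1 - l) \<cdot>\<^sub>m Y"
    if "dim_row X = m" "dim_col X = m" "dim_row Y = m" "dim_col Y = m" for X Y
    using that by (simp add: K_def mat_expand canc ab zero' s0 del: of_real_diff)
  have KK: "K\<^sup>\<dagger> * K = 1\<^sub>m m"
    using compress[of "1\<^sub>m m" "1\<^sub>m m"] by (simp add: mult_one_dim flip: K_def) (auto simp: algebra_simps intro!: eq_matI)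
  define C where "C = K * J\<^sup>\<dagger>"
  have [simp]: "dim_row C = n" "dim_col C = n" by (auto simp: C_def)
  have "contraction_mat n C" unfolding contraction_mat_iff
  proof (intro conjI allI impI)
    fix x :: "complex mat" assume x: "dim_row x = n" "dim_col x = 1"
    have "C\<^sup>\<dagger> * C = (J\<^sup>\<dagger>)\<^sup>\<dagger> * J\<^sup>\<dagger>" by (simp add: C_def mat_expand mult_cancel_dim[OF KK])
    then have "qf (C\<^sup>\<dagger> * C) x = qf (1\<^sub>m m) (J\<^sup>\<dagger> * x)" using qf_gram[of "J\<^sup>\<dagger>" n x m] x by simp
    also have "\<dots> \<le> qf (1\<^sub>m n) x" using proj[OF x] qf_one_nonneg[of "L\<^sup>\<dagger> * x" m] x by simp
    finally show "qf (C\<^sup>\<dagger> * C) x \<le> qf (1\<^sub>m n) x" .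
  qed auto
  then have "loewner_le n (C\<^sup>\<dagger> * mat_fun f At * C) (mat_fun f (C\<^sup>\<dagger> * At * C))"
    using ineq At unfolding matrix_contraction_ineq_def by blast
  from loewner_le_congruence[OF this, of J m]
  have le: "loewner_le m (J\<^sup>\<dagger> * (C\<^sup>\<dagger> * mat_fun f At * C) * J) (J\<^sup>\<dagger> * mat_fun f (C\<^sup>\<dagger> * At * C) * J)" by simp
  have CJ: "C * J = K" by (simp add: C_def mat_expand canc mult_one_dim)
  have "J\<^sup>\<dagger> * (C\<^sup>\<dagger> * mat_fun f At * C) * J = (C * J)\<^sup>\<dagger> * (mat_fun f At * (C * J))" by (simp add: mat_expand)
  also have "mat_fun f At * (C * J) = a \<cdot>\<^sub>m (J * mat_fun f A) + b \<cdot>\<^sub>m (L * mat_fun f B)"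
    unfolding CJ by (simp add: K_def mat_expand fJ fL)
  also have "(C * J)\<^sup>\<dagger> * \<dots> = complex_of_real l \<cdot>\<^sub>m mat_fun f A + complex_of_real (1 - l) \<cdot>\<^sub>m mat_fun f B"
    unfolding CJ by (rule compress) auto
  finally have left: "J\<^sup>\<dagger> * (C\<^sup>\<dagger> * mat_fun f At * C) * J = complex_of_real l \<cdot>\<^sub>m mat_fun f A + complex_of_real (1 - l) \<cdot>\<^sub>m mat_fun f B" .
  define D where "D = complex_of_real l \<cdot>\<^sub>m A + complex_of_real (1 - l) \<cdot>\<^sub>m B"
  have [simp]: "dim_row D = m" "dim_col D = m" by (auto simp: D_def)
  have hD: "hermitian_mat m D" unfolding D_def by (intro hermitian_matI) auto
  note [simp] = dim_mat_fun[OF hD]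
  have AtK: "At * K = a \<cdot>\<^sub>m (J * A) + b \<cdot>\<^sub>m (L * B)"
    unfolding K_def by (simp add: At_def mat_expand canc zero)
  have hC: "hermitian_mat n (C\<^sup>\<dagger> * At * C)" by (rule hermitian_congruence[OF hAt]) auto
  note [simp] = dim_mat_fun[OF hC]
  have "K\<^sup>\<dagger> * (At * K) = D" unfolding AtK D_def by (rule compress) auto
  then have "C\<^sup>\<dagger> * At * C * J = J * D" by (simp add: C_def mat_expand canc mult_one_dim)
  then have fCJ: "mat_fun f (C\<^sup>\<dagger> * At * C) * J = J * mat_fun f D" by (intro mat_fun_intertwine[OF hC hD]) auto
  have "J\<^sup>\<dagger> * mat_fun f (C\<^sup>\<dagger> * At * C) * J = J\<^sup>\<dagger> * (mat_fun f (C\<^sup>\<dagger> * At * C) * J)"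
    by (rule mult_assoc_dim) simp_all
  also have "\<dots> = mat_fun f D" unfolding fCJ by (simp add: canc)
  finally have "J\<^sup>\<dagger> * mat_fun f (C\<^sup>\<dagger> * At * C) * J = mat_fun f D" .
  with le show "loewner_le m (complex_of_real l \<cdot>\<^sub>m mat_fun f A + complex_of_real (1 - l) \<cdot>\<^sub>m mat_fun f B)
      (mat_fun f (complex_of_real l \<cdot>\<^sub>m A + complex_of_real (1 - l) \<cdot>\<^sub>m B))"
    unfolding left D_def by simp
qed

text \<open>
  By the intermediate value theorem, as \<open>f\<close> has no zero.
\<close>

lemma continuous_positive:
  fixes f :: "real \<Rightarrow> real"
  assumes f: "continuous_on {0..<\<alpha>} f" "0 \<notin> f ` {0..<\<alpha>}" and f0: "f 0 \<ge> 0" and t: "t \<in> {0..<\<alpha>}"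
  shows "f t > 0"
proof (rule ccontr)
  assume "\<not> f t > 0"
  moreover have "continuous_on {0..t} f" by (rule continuous_on_subset[OF f(1)]) (use t in auto)
  ultimately obtain s where "0 \<le> s" "s \<le> t" "f s = 0" using IVT2'[of f t 0 0] f0 t by auto
  then show False using f(2) t by (force simp: image_iff)
qed

lemma loewner_le_scalar_iff:
  assumes "n \<ge> 1"
  shows "loewner_le n (complex_of_real a \<cdot>\<^sub>m 1\<^sub>m n) (complex_of_real b \<cdot>\<^sub>m 1\<^sub>m n) \<longleftrightarrow> a \<le> b"
proof
  assume le: "loewner_le n (complex_of_real a \<cdot>\<^sub>m 1\<^sub>m n) (complex_of_real b \<cdot>\<^sub>m 1\<^sub>m n)"
  define x where "x = embed n 1 0"
  have x: "dim_row x = n" "dim_col x = 1" by (auto simp: x_def)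
  have "x\<^sup>\<dagger> * x = 1\<^sub>m 1" unfolding x_def using assms by (intro embed_isometry) simp
  then have "qf (1\<^sub>m n) x = 1" using x by (simp add: qf_def one_mult_dim)
  moreover have "qf (complex_of_real a \<cdot>\<^sub>m 1\<^sub>m n) x \<le> qf (complex_of_real b \<cdot>\<^sub>m 1\<^sub>m n) x"
    using le x unfolding loewner_le_iff by blast
  ultimately show "a \<le> b" using x by (simp add: qf_smult[of _ n])
next
  assume "a \<le> b"
  then show "loewner_le n (complex_of_real a \<cdot>\<^sub>m 1\<^sub>m n) (complex_of_real b \<cdot>\<^sub>m 1\<^sub>m n)"
    by (intro loewner_leI hermitian_scalar) (simp add: qf_smult[of _ n] mult_right_mono qf_one_nonneg)
qed

text \<open>
  The case \<open>A = C = 0\<close>.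
\<close>

lemma contraction_ineq_imp_nonneg:
  assumes ineq: "matrix_contraction_ineq n {0..<\<alpha>} f" and "\<alpha> > 0" and n: "n \<ge> 1"
  shows "f 0 \<ge> 0"
proof -
  let ?O = "complex_of_real 0 \<cdot>\<^sub>m 1\<^sub>m n"
  have h: "hermitian_on n {0..<\<alpha>} ?O" by (rule hermitian_on_scalar) (use \<open>\<alpha> > 0\<close> in auto)
  have "contraction_mat n ?O"
    unfolding contraction_mat_iff by (auto simp: mat_expand qf_smult[of _ n, of _ _ 0, simplified] qf_one_nonneg)
  then have "loewner_le n (?O\<^sup>\<dagger> * mat_fun f ?O * ?O) (mat_fun f (?O\<^sup>\<dagger> * ?O * ?O))"
    using ineq h unfolding matrix_contraction_ineq_def by blast
  moreover have "?O\<^sup>\<dagger> * ?O * ?O = ?O" by (auto simp: mat_expand)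
  moreover have "?O\<^sup>\<dagger> * mat_fun f ?O * ?O = ?O" unfolding mat_fun_scalar by (auto simp: mat_expand)
  ultimately have "loewner_le n ?O (complex_of_real (f 0) \<cdot>\<^sub>m 1\<^sub>m n)" using mat_fun_scalar[of f 0 n] by metis
  then show ?thesis using loewner_le_scalar_iff[OF n, of 0 "f 0"] by blast
qed

text \<open>
  If \<open>f(0) < 0\<close>, then \<open>g < 0\<close> on \<open>(0,\<alpha>)\<close>, but \<open>g(s) \<le> g(t)\<close> for \<open>s < t\<close> and \<open>g(s) \<rightarrow> 0\<close> as \<open>s \<rightarrow> 0\<close>.
\<close>

lemma monotone_imp_nonneg:
  assumes mono: "matrix_monotone n {0<..<\<alpha>} (\<lambda>t. t / f t)" and "\<alpha> > 0" and n: "n \<ge> 1"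
    and f: "continuous_on {0..<\<alpha>} f" "0 \<notin> f ` {0..<\<alpha>}"
  shows "f 0 \<ge> 0"
proof (rule ccontr)
  assume "\<not> f 0 \<ge> 0"
  then have "- f t > 0" if "t \<in> {0..<\<alpha>}" for t
    using continuous_positive[of \<alpha> "\<lambda>t. - f t" t] f that by (force intro: continuous_intros simp: image_iff)
  then have neg: "f t < 0" if "t \<in> {0..<\<alpha>}" for t using that by force
  define t where "t = \<alpha> / 2"
  have t: "0 < t" "t < \<alpha>" using \<open>\<alpha> > 0\<close> by (auto simp: t_def)
  have le: "s / f s \<le> t / f t" if s: "0 < s" "s \<le> t" for s
  proof -
    have "loewner_le n (complex_of_real s \<cdot>\<^sub>m 1\<^sub>m n) (complex_of_real t \<cdot>\<^sub>m 1\<^sub>m n)"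
      using loewner_le_scalar_iff[OF n] s by blast
    moreover have "hermitian_on n {0<..<\<alpha>} (complex_of_real s \<cdot>\<^sub>m 1\<^sub>m n)" "hermitian_on n {0<..<\<alpha>} (complex_of_real t \<cdot>\<^sub>m 1\<^sub>m n)"
      using s t by (auto intro!: hermitian_on_scalar)
    ultimately have "loewner_le n (mat_fun (\<lambda>t. t / f t) (complex_of_real s \<cdot>\<^sub>m 1\<^sub>m n)) (mat_fun (\<lambda>t. t / f t) (complex_of_real t \<cdot>\<^sub>m 1\<^sub>m n))"
      using mono unfolding matrix_monotone_def by blast
    then show ?thesis unfolding mat_fun_scalar using loewner_le_scalar_iff[OF n] by blast
  qed
  have "continuous_on {0..<\<alpha>} (\<lambda>s. s / f s)" by (intro continuous_intros f) (use f in \<open>auto simp: image_iff\<close>)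
  then have "((\<lambda>s. s / f s) \<longlongrightarrow> 0 / f 0) (at 0 within {0..<\<alpha>})"
    using \<open>\<alpha> > 0\<close> unfolding continuous_on_def by force
  then have lim: "((\<lambda>s. s / f s) \<longlongrightarrow> 0 / f 0) (at 0 within {0<..<\<alpha>})" by (rule tendsto_within_subset) auto
  have at: "at 0 within {0<..<\<alpha>} = at_right 0" by (rule at_within_nhd[of 0 "{..<\<alpha>}"]) (use \<open>\<alpha> > 0\<close> in auto)
  have "eventually (\<lambda>s. s \<in> {0<..<t}) (at_right 0)" using eventually_at_right_real[OF t(1)] .
  then have "eventually (\<lambda>s. s / f s \<le> t / f t) (at_right 0)" by eventually_elim (use le in auto)
  then have "0 / f 0 \<le> t / f t" using lim unfolding at by (intro tendsto_upperbound) auto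
  moreover have "t / f t < 0" using t neg[of t] by (simp add: divide_less_0_iff)
  ultimately show False by simp
qed

theorem theorem2p1:
  fixes n :: nat and \<alpha> :: real and f :: "real \<Rightarrow> real"
  assumes "n \<ge> 1" and "\<alpha> > 0"
    and "continuous_on {0..<\<alpha>} f"
    and "0 \<notin> f ` {0..<\<alpha>}"
  shows
    "(matrix_concave (n + 1) {0..<\<alpha>} f \<and> f 0 \<ge> 0 \<longrightarrow> matrix_contraction_ineq n {0..<\<alpha>} f) \<and>
     (matrix_contraction_ineq n {0..<\<alpha>} f \<longleftrightarrow> matrix_monotone n {0<..<\<alpha>} (\<lambda>t. t / f t)) \<and>
     (matrix_monotone n {0<..<\<alpha>} (\<lambda>t. t / f t) \<longrightarrow>
        (n div 2 \<noteq> 0 \<longrightarrow> matrix_concave (n div 2) {0..<\<alpha>} f \<and> f 0 \<ge> 0))"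
proof -
  note pos = continuous_positive[OF assms(3,4)]
  have mono_contr: "matrix_contraction_ineq n {0..<\<alpha>} f" if "matrix_monotone n {0<..<\<alpha>} (\<lambda>t. t / f t)"
    using that assms monotone_imp_nonneg[OF that] pos by (intro monotone_imp_contraction_ineq) auto
  have rank_one_mono: "matrix_monotone n {0<..<\<alpha>} (\<lambda>t. t / f t)"
    if "rank_one_contraction_ineq n {0..<\<alpha>} f" "f 0 \<ge> 0"
    using that assms pos by (intro rank_one_imp_monotone) auto
  have "matrix_contraction_ineq n {0..<\<alpha>} f" if "matrix_concave (n + 1) {0..<\<alpha>} f" "f 0 \<ge> 0"
    using concave_imp_rank_one[OF that \<open>\<alpha> > 0\<close>] that(2) rank_one_mono mono_contr by blast
  moreover have "matrix_monotone n {0<..<\<alpha>} (\<lambda>t. t / f t)" if "matrix_contraction_ineq n {0..<\<alpha>} f"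
    using contraction_ineq_imp_rank_one[OF that] contraction_ineq_imp_nonneg[OF that assms(2,1)] rank_one_mono by blast
  moreover have "matrix_concave (n div 2) {0..<\<alpha>} f \<and> f 0 \<ge> 0" if "matrix_monotone n {0<..<\<alpha>} (\<lambda>t. t / f t)"
    using contraction_ineq_imp_concave[OF mono_contr[OF that] \<open>\<alpha> > 0\<close>, of "n div 2"]
      contraction_ineq_imp_nonneg[OF mono_contr[OF that] assms(2,1)] by simp
  ultimately show ?thesis using mono_contr by blast
qed

end
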